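(* Let $m = m_n$ be positive integers with $m^2 \to \infty$ and $m^2/n \to 0$ as $n \to \infty$, and let $A_1,\ldots,A_n$ be independent $m \times m$ GOE matrices. Let $\xi = \xi_m$ be the sequence tending to $1$ as $m\to\infty$ described in the context. Then for any constants $\beta < 1 < \gamma$, \[ \lim_{n \to \infty} \mathbb{P}\left(\beta\frac{2}{e^{3/4}}\sqrt{nm}\,4^{-\xi n/m^2} \leq \mathrm{disc}(A_1,\ldots,A_n) \leq \gamma\frac{2}{e^{3/4}}\sqrt{nm}\,4^{-\xi n/m^2}\right) = 1. \]
   Context: An $m\times m$ GOE matrix is a random symmetric matrix whose entries on and above the diagonal are independent centered normal variables, with variance $2$ on the diagonal and variance $1$ off the diagonal. For symmetric matrices $A_1,\ldots,A_n$, $\mathrm{disc}(A_1,\ldots,A_n) = \min_{x \in \{\pm1\}^n} \|\sum_{i=1}^n x_iA_i\|$, where $\|\cdot\|$ is the spectral norm. The sequence $\xi=\xi_m$ is defined through the small-ball probability of a single $m\times m$ GOE matrix $X$: it tends to $1$ as $m\to\infty$ and satisfies $\mathbb{P}(\|X\| \leq \delta) = \left(\frac{e^{3/4}}{2\sqrt{m}}\delta\right)^{\xi^{-1}m^2/2}$ (for the values $\delta = o(\sqrt m)$ under consideration). *)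

theory Defs
  imports "HOL-Probability.Probability"
begin

definition goe_index :: "nat \<Rightarrow> nat \<Rightarrow> (nat \<times> nat \<times> nat) set" where
  "goe_index n m = {(k,i,j). k < n \<and> i \<le> j \<and> j < m}"

definition goe_space :: "nat \<Rightarrow> nat \<Rightarrow> ((nat \<times> nat \<times> nat) \<Rightarrow> real) measure" where
  "goe_space n m = PiM (goe_index n m)
     (\<lambda>(k,i,j). density lborel (normal_density 0 (if i = j then sqrt 2 else 1)))"

definition goe_mat :: "((nat \<times> nat \<times> nat) \<Rightarrow> real) \<Rightarrow> nat \<Rightarrow> nat \<Rightarrow> nat \<Rightarrow> real" where
  "goe_mat \<omega> k i j = \<omega> (k, min i j, max i j)"

definition spec_norm :: "nat \<Rightarrow> (nat \<Rightarrow> nat \<Rightarrow> real) \<Rightarrow> real" where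
  "spec_norm m A = Sup {sqrt (\<Sum>i<m. (\<Sum>j<m. A i j * v j)^2) | v. (\<Sum>j<m. (v j)^2) = 1}"

definition disc :: "nat \<Rightarrow> nat \<Rightarrow> (nat \<Rightarrow> nat \<Rightarrow> nat \<Rightarrow> real) \<Rightarrow> real" where
  "disc n m A = Min ((\<lambda>x. spec_norm m (\<lambda>i j. \<Sum>k<n. x k * A k i j))
                      ` (PiE {..<n} (\<lambda>_. {-1, 1})))"

end

theory Submission
  imports Defs
begin

text \<open>A signed sum of the \<open>A\<^sub>k\<close> is distributed as \<open>sqrt n\<close> times one GOE matrix \<open>X\<close>, and the normalisation
  of \<open>\<xi>\<close> says exactly that \<open>P(\<parallel>X\<parallel> \<le> \<delta>) = 2\<^sup>-\<^sup>n\<close>. Changing \<open>\<delta>\<close> by a constant factor changes this probability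
  by that factor to the power \<open>d = m (m + 1) / 2\<close>, up to \<open>exp (o d)\<close>, because
  the Gaussian density is nearly constant on a ball of radius \<open>o (sqrt m)\<close>. Hence the expected number of signings
  below the threshold tends to \<open>0\<close> for \<open>\<beta> < 1\<close> and to infinity for \<open>\<gamma> > 1\<close>.

  For the second moment, two signings with correlation \<open>\<rho>\<close> are jointly below the threshold with probability at
  most \<open>(1 - \<rho>\<^sup>2)\<^sup>-\<^sup>d\<^sup>/\<^sup>2 p\<^sup>2\<close>: condition on the first one and remove the resulting shift of the norm ball by
  Anderson's inequality. Averaging over the signings gives \<open>1 + o(1)\<close> because \<open>d / n\<close> tends to \<open>0\<close>.

  Anderson's inequality \<open>G(K + a) \<le> G(K)\<close> for the Gaussian measure \<open>G\<close> is obtained without Prekopa-Leindler: rotating two independent copies by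
  45 degrees writes \<open>G(K + a)\<^sup>2\<close> as an average of \<open>G(K' + sqrt 2 a)\<close> over symmetric convex \<open>K'\<close>, so an
  optimal constant \<open>C\<close> in \<open>G(K + a) \<le> C G(K)\<close> satisfies \<open>C\<^sup>2 \<le> C\<close> as soon as it is finite.\<close>

section \<open>Gaussian weights on finite products\<close>

text \<open>The hypothesis on \<xi> fixes the small-ball probability at one radius \<delta> for each
  n; every other radius is reached from it by dilating the ball. The obstacle is a thin surplus. At
  radius \<gamma> \<delta> the expected number of good signings is only about exp (d ln \<gamma>)
  with d = o(n), while a signing and its near copies or near negatives are hardly less likely
  together than alone, so that such a pair may cost a factor 1 / p of order almost 2^n. Pairs
  charged in this way are therefore confined to Hamming distance exp (- l) n from 0 or n, where l =
  n / (16 d) tends to infinity: each signing has only exp (o d) such partners, which the surplus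
  beats. Beyond that cut the overlap factor is at most exp (n / 32), an exponential rate that the
  binomial tail beats. The Gaussian part allows a separate variance for each coordinate, since
  diagonal and off-diagonal entries differ; the coordinates are the d independent entries on and
  above the diagonal.\<close>

locale gaussian_weight =
  fixes I :: "'i set" and \<sigma> :: "'i \<Rightarrow> real"
  assumes finite_I [simp, intro]: "finite I"
    and \<sigma>_pos: "i \<in> I \<Longrightarrow> 0 < \<sigma> i"
begin

definition L :: "('i \<Rightarrow> real) measure" where
  "L = PiM I (\<lambda>_. lborel)"

definition q :: "('i \<Rightarrow> real) \<Rightarrow> real" where
  "q x = (\<Sum>i\<in>I. (x i)\<^sup>2 / (2 * (\<sigma> i)\<^sup>2))"

definition w :: "('i \<Rightarrow> real) \<Rightarrow> ennreal" where
  "w x = ennreal (exp (- q x))"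

text \<open>Points of \<open>L\<close> are extensional on \<open>I\<close>, and arithmetic on
  functions leaves that space. Invariance under restriction makes the value at any total function
  equal to the value at a point of \<open>L\<close>, so substitutions need no
  \<open>restrict\<close>.\<close>

definition coord_measurable :: "(('i \<Rightarrow> real) \<Rightarrow> ennreal) \<Rightarrow> bool" where
  "coord_measurable f \<longleftrightarrow> f \<in> borel_measurable L \<and> (\<forall>x. f (restrict x I) = f x)"

definition coord_measurable2 :: "(('i \<Rightarrow> real) \<Rightarrow> ('i \<Rightarrow> real) \<Rightarrow> ennreal) \<Rightarrow> bool" where
  "coord_measurable2 F \<longleftrightarrow> (\<lambda>(x, y). F x y) \<in> borel_measurable (L \<Otimes>\<^sub>M L) \<and>
     (\<forall>x y. F (restrict x I) (restrict y I) = F x y)"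

sublocale PL: product_sigma_finite "\<lambda>_::'i. lborel :: real measure" ..

lemma sigma_finite_L: "sigma_finite_measure L"
  unfolding L_def by (rule PL.sigma_finite) simp

sublocale LL: pair_sigma_finite L L
  by (intro pair_sigma_finite.intro sigma_finite_L)

lemma measurable_to_L:
  assumes "\<And>i. i \<in> I \<Longrightarrow> g i \<in> borel_measurable N"
  shows "(\<lambda>\<omega>. \<lambda>i\<in>I. g i \<omega>) \<in> measurable N L"
  unfolding L_def using assms by (intro measurable_restrict) simp

lemma measurable_coord_L [measurable]: "i \<in> I \<Longrightarrow> (\<lambda>x. x i) \<in> borel_measurable L"
  unfolding L_def by measurable

lemma coord_measurable_comp:
  assumes f: "coord_measurable f" and "\<And>i. i \<in> I \<Longrightarrow> g i \<in> borel_measurable N"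
  shows "(\<lambda>\<omega>. f (\<lambda>i. g i \<omega>)) \<in> borel_measurable N"
proof -
  have "(\<lambda>\<omega>. f (\<lambda>i\<in>I. g i \<omega>)) \<in> borel_measurable N"
    using f measurable_to_L[OF assms(2)]
    by (intro measurable_compose[where f="\<lambda>\<omega>. \<lambda>i\<in>I. g i \<omega>" and N=L and g=f])
      (auto simp: coord_measurable_def)
  moreover have "f (\<lambda>i\<in>I. g i \<omega>) = f (\<lambda>i. g i \<omega>)" for \<omega>
    using f by (auto simp: coord_measurable_def)
  ultimately show ?thesis by simp
qed

lemma coord_measurable2_comp:
  assumes F: "coord_measurable2 F"
    and g: "\<And>i. i \<in> I \<Longrightarrow> g i \<in> borel_measurable N"
    and h: "\<And>i. i \<in> I \<Longrightarrow> h i \<in> borel_measurable N"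
  shows "(\<lambda>\<omega>. F (\<lambda>i. g i \<omega>) (\<lambda>i. h i \<omega>)) \<in> borel_measurable N"
proof -
  have "(\<lambda>\<omega>. (\<lambda>(x, y). F x y) (\<lambda>i\<in>I. g i \<omega>, \<lambda>i\<in>I. h i \<omega>)) \<in> borel_measurable N"
    using F measurable_to_L[of g N, OF g] measurable_to_L[of h N, OF h]
    by (intro measurable_compose[where f="\<lambda>\<omega>. (\<lambda>i\<in>I. g i \<omega>, \<lambda>i\<in>I. h i \<omega>)" and N="L \<Otimes>\<^sub>M L"
          and g="\<lambda>(x, y). F x y"] measurable_Pair)
      (auto simp: coord_measurable2_def)
  moreover have "F (\<lambda>i\<in>I. g i \<omega>) (\<lambda>i\<in>I. h i \<omega>) = F (\<lambda>i. g i \<omega>) (\<lambda>i. h i \<omega>)" for \<omega>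
    using F by (auto simp: coord_measurable2_def)
  ultimately show ?thesis by simp
qed

text \<open>Both measures agree on boxes, where the claim splits into the one-dimensional change of
  variables with one factor |t| per coordinate. Negative \<open>t\<close> is covered because
  reflections occur in the rotation and in the doubling step.\<close>

lemma L_affine:
  fixes t :: real
  assumes t: "t \<noteq> 0"
  shows "density (distr L L (\<lambda>x. \<lambda>i\<in>I. a i + t * x i)) (\<lambda>_. ennreal (\<bar>t\<bar> ^ card I)) = L"
    (is "?P = _")
proof -
  have meas: "(\<lambda>x. \<lambda>i\<in>I. a i + t * x i) \<in> measurable L L"
    by (intro measurable_to_L) simp
  have "?P = PiM I (\<lambda>_. lborel)"
  proof (rule PL.PiM_eqI)
    show "sets ?P = sets (PiM I (\<lambda>_. lborel))" by (simp add: L_def)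
    fix A :: "'i \<Rightarrow> real set" assume A: "\<And>i. i \<in> I \<Longrightarrow> A i \<in> sets lborel"
    have PA: "PiE I A \<in> sets L" unfolding L_def using A by (intro sets_PiM_I_finite) auto
    have vim: "(\<lambda>x. \<lambda>i\<in>I. a i + t * x i) -` PiE I A \<inter> space L
        = PiE I (\<lambda>i. (\<lambda>x. a i + t * x) -` A i)"
      by (auto simp: L_def space_PiM PiE_def Pi_def extensional_def)
    have pre: "(\<lambda>x. a i + t * x) -` A i \<in> sets lborel" if "i \<in> I" for i
      using measurable_sets[of "\<lambda>x. a i + t * x" lborel lborel "A i"] A[OF that] by simp
    have one: "ennreal \<bar>t\<bar> * emeasure lborel ((\<lambda>x. a i + t * x) -` A i) = emeasure lborel (A i)"
      if "i \<in> I" for i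
    proof -
      have "emeasure lborel (A i) = emeasure (density (distr lborel borel (\<lambda>x. a i + t * x)) (\<lambda>_. ennreal \<bar>t\<bar>)) (A i)"
        using lborel_real_affine[OF t, of "a i"] by simp
      also have "\<dots> = ennreal \<bar>t\<bar> * emeasure lborel ((\<lambda>x. a i + t * x) -` A i)"
        using A[OF that] by (simp add: emeasure_density_const emeasure_distr)
      finally show ?thesis by simp
    qed
    have "emeasure ?P (PiE I A) = ennreal (\<bar>t\<bar> ^ card I) * emeasure L (PiE I (\<lambda>i. (\<lambda>x. a i + t * x) -` A i))"
      using PA meas by (simp add: emeasure_density_const emeasure_distr vim)
    also have "emeasure L (PiE I (\<lambda>i. (\<lambda>x. a i + t * x) -` A i))
        = (\<Prod>i\<in>I. emeasure lborel ((\<lambda>x. a i + t * x) -` A i))"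
      unfolding L_def by (rule PL.emeasure_PiM) (use pre in auto)
    finally have "emeasure ?P (PiE I A)
        = (\<Prod>i\<in>I. ennreal \<bar>t\<bar> * emeasure lborel ((\<lambda>x. a i + t * x) -` A i))"
      by (simp only: prod.distrib prod_constant ennreal_power abs_ge_zero)
    then show "emeasure ?P (PiE I A) = (\<Prod>i\<in>I. emeasure lborel (A i))"
      using one by (simp only: cong: prod.cong)
  qed simp
  then show ?thesis by (simp add: L_def)
qed

lemma nn_integral_L_affine:
  fixes t :: real
  assumes f: "coord_measurable f" and t: "t \<noteq> 0"
  shows "(\<integral>\<^sup>+x. f x \<partial>L) = ennreal (\<bar>t\<bar> ^ card I) * (\<integral>\<^sup>+x. f (\<lambda>i. a i + t * x i) \<partial>L)"
proof -
  have meas: "(\<lambda>x. \<lambda>i\<in>I. a i + t * x i) \<in> measurable L L"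
    by (intro measurable_to_L) simp
  have [measurable]: "f \<in> borel_measurable L" and fr: "f (restrict x I) = f x" for x
    using f by (auto simp: coord_measurable_def)
  have "(\<integral>\<^sup>+x. f x \<partial>L) = (\<integral>\<^sup>+x. f x \<partial>density (distr L L (\<lambda>x. \<lambda>i\<in>I. a i + t * x i)) (\<lambda>_. ennreal (\<bar>t\<bar> ^ card I)))"
    by (simp add: L_affine[OF t])
  also have "\<dots> = ennreal (\<bar>t\<bar> ^ card I) * (\<integral>\<^sup>+x. f (\<lambda>i\<in>I. a i + t * x i) \<partial>L)"
    using meas by (simp add: nn_integral_density nn_integral_distr nn_integral_cmult)
  finally show ?thesis by (simp add: fr)
qed

lemma coord_measurable_compI:
  assumes f: "coord_measurable f" and g: "\<And>i. i \<in> I \<Longrightarrow> (\<lambda>x. g i (x i)) \<in> borel_measurable L"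
  shows "coord_measurable (\<lambda>x. f (\<lambda>i. g i (x i)))"
proof -
  have "f (\<lambda>i. g i (restrict x I i)) = f (\<lambda>i. g i (x i))" for x
  proof -
    have "f (\<lambda>i. g i (restrict x I i)) = f (restrict (\<lambda>i. g i (restrict x I i)) I)"
      using f by (simp add: coord_measurable_def)
    also have "restrict (\<lambda>i. g i (restrict x I i)) I = restrict (\<lambda>i. g i (x i)) I"
      by auto
    also have "f \<dots> = f (\<lambda>i. g i (x i))" using f unfolding coord_measurable_def by blast
    finally show ?thesis .
  qed
  with coord_measurable_comp[OF f g] show ?thesis
    unfolding coord_measurable_def by auto
qed

lemma coord_measurable2_eq:
  assumes "coord_measurable2 F" "\<And>i. i \<in> I \<Longrightarrow> x i = x' i" "\<And>i. i \<in> I \<Longrightarrow> y i = y' i"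
  shows "F x y = F x' y'"
proof -
  have "restrict x I = restrict x' I" "restrict y I = restrict y' I" using assms by auto
  then show ?thesis using assms(1) unfolding coord_measurable2_def by metis
qed

lemma coord_measurable2_partial:
  assumes F: "coord_measurable2 F"
    and g: "\<And>i. i \<in> I \<Longrightarrow> g i \<in> borel_measurable borel"
    and h: "\<And>i. i \<in> I \<Longrightarrow> h i \<in> borel_measurable borel"
  shows "coord_measurable (\<lambda>x. F (\<lambda>i. g i (x i)) (\<lambda>i. h i (x i)))"
  unfolding coord_measurable_def
proof (intro conjI allI)
  show "(\<lambda>x. F (\<lambda>i. g i (x i)) (\<lambda>i. h i (x i))) \<in> borel_measurable L"
    by (intro coord_measurable2_comp[OF F, of "\<lambda>i x. g i (x i)" L "\<lambda>i x. h i (x i)"])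
      (use g h in \<open>auto intro: measurable_compose[OF measurable_coord_L]\<close>)
qed (auto intro: coord_measurable2_eq[OF F])

text \<open>The map from (x, y) to (c x + s y, s x - c y) is orthogonal. It is factored into two
  substitutions, each moving one argument while the other is frozen, with Fubini in between. Each
  produces the Jacobian factor \<open>c ^ card I\<close>, on opposite sides of the equation, so it
  cancels.\<close>

lemma rotation_L:
  assumes F: "coord_measurable2 F" and cs: "c\<^sup>2 + s\<^sup>2 = 1" and c: "0 < c"
  shows "(\<integral>\<^sup>+y. \<integral>\<^sup>+x. F (\<lambda>i. c * x i + s * y i) (\<lambda>i. s * x i - c * y i) \<partial>L \<partial>L)
       = (\<integral>\<^sup>+x. \<integral>\<^sup>+y. F x y \<partial>L \<partial>L)" (is "?l = ?r")
proof -
  let ?d = "ennreal (c ^ card I)"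
  have meas: "(\<lambda>(x, y). F x (\<lambda>i. (s * x i - y i) / c)) \<in> borel_measurable (L \<Otimes>\<^sub>M L)"
    using coord_measurable2_comp[OF F, of "\<lambda>i z. fst z i" "L \<Otimes>\<^sub>M L" "\<lambda>i z. (s * fst z i - snd z i) / c"]
    by (simp add: split_beta')
  have meas': "(\<lambda>(y, x). F (\<lambda>i. c * x i + s * y i) (\<lambda>i. s * x i - c * y i)) \<in> borel_measurable (L \<Otimes>\<^sub>M L)"
    using coord_measurable2_comp[OF F, of "\<lambda>i z. c * snd z i + s * fst z i" "L \<Otimes>\<^sub>M L" "\<lambda>i z. s * snd z i - c * fst z i"]
    by (simp add: split_beta')
  have meas'': "(\<lambda>(x, y). F x y) \<in> borel_measurable (L \<Otimes>\<^sub>M L)"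
    using F by (simp add: coord_measurable2_def)
  have inner: "?d * (\<integral>\<^sup>+x. F (\<lambda>i. c * x i + s * y i) (\<lambda>i. s * x i - c * y i) \<partial>L)
      = (\<integral>\<^sup>+x. F x (\<lambda>i. (s * x i - y i) / c) \<partial>L)" for y
  proof -
    have "coord_measurable (\<lambda>x. F x (\<lambda>i. (s * x i - y i) / c))"
      using coord_measurable2_partial[OF F, of "\<lambda>i x. x" "\<lambda>i x. (s * x - y i) / c"] by simp
    from nn_integral_L_affine[OF this, of c "\<lambda>i. s * y i"] c
    have "(\<integral>\<^sup>+x. F x (\<lambda>i. (s * x i - y i) / c) \<partial>L) = ?d *
        (\<integral>\<^sup>+x. F (\<lambda>i. s * y i + c * x i) (\<lambda>i. (s * (s * y i + c * x i) - y i) / c) \<partial>L)" by simp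
    moreover have "(s * (s * b + c * a) - b) / c = s * a - c * b" for a b
    proof -
      have "s * (s * b + c * a) - b = (c\<^sup>2 + s\<^sup>2 - 1) * b + c * (s * a - c * b)" by algebra
      then show ?thesis using cs c by simp
    qed
    ultimately show ?thesis by (simp add: add.commute)
  qed
  have outer: "(\<integral>\<^sup>+y. F x (\<lambda>i. (s * x i - y i) / c) \<partial>L) = ?d * (\<integral>\<^sup>+y. F x y \<partial>L)" for x
  proof -
    have "coord_measurable (\<lambda>y. F x (\<lambda>i. (s * x i - y i) / c))"
      using coord_measurable2_partial[OF F, of "\<lambda>i y. x i" "\<lambda>i y. (s * x i - y) / c"] by simp
    from nn_integral_L_affine[OF this, of "- c" "\<lambda>i. s * x i"] c
    show ?thesis by simp
  qed
  have "?d * ?l = (\<integral>\<^sup>+y. \<integral>\<^sup>+x. F x (\<lambda>i. (s * x i - y i) / c) \<partial>L \<partial>L)"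
    using sigma_finite_measure.borel_measurable_nn_integral[OF sigma_finite_L meas'] by (simp flip: inner add: nn_integral_cmult)
  also have "\<dots> = (\<integral>\<^sup>+x. \<integral>\<^sup>+y. F x (\<lambda>i. (s * x i - y i) / c) \<partial>L \<partial>L)"
    by (rule LL.Fubini'[OF meas])
  also have "\<dots> = ?d * ?r"
    using sigma_finite_measure.borel_measurable_nn_integral[OF sigma_finite_L meas''] by (simp add: outer nn_integral_cmult)
  finally show ?thesis using c by (simp add: ennreal_mult_cancel_left)
qed

section \<open>The quadratic form of the weight and its invariance under rotations\<close>

lemma q_nonneg: "0 \<le> q x"
  unfolding q_def by (intro sum_nonneg) simp

lemma q_parallelogram: "q (\<lambda>i. x i + y i) + q (\<lambda>i. x i - y i) = 2 * q x + 2 * q y"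
proof -
  have "(a + b)\<^sup>2 / r + (a - b)\<^sup>2 / r = 2 * (a\<^sup>2 / r) + 2 * (b\<^sup>2 / r)" for a b r :: real
    by (simp add: power2_eq_square field_simps flip: add_divide_distrib)
  then show ?thesis by (simp add: q_def sum_distrib_left flip: sum.distrib)
qed

lemma q_scale: "q (\<lambda>i. t * x i) = t\<^sup>2 * q x"
  by (simp add: q_def sum_distrib_left power_mult_distrib)

lemma q_rotation:
  assumes "c\<^sup>2 + s\<^sup>2 = 1"
  shows "q (\<lambda>i. c * x i + s * y i) + q (\<lambda>i. s * x i - c * y i) = q x + q y"
proof -
  have "(c * a + s * b)\<^sup>2 + (s * a - c * b)\<^sup>2 = a\<^sup>2 + b\<^sup>2" for a b :: real
  proof -
    have "(c * a + s * b)\<^sup>2 + (s * a - c * b)\<^sup>2 = (c\<^sup>2 + s\<^sup>2) * (a\<^sup>2 + b\<^sup>2)" by algebra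
    then show ?thesis using assms by simp
  qed
  then show ?thesis by (simp add: q_def flip: sum.distrib add_divide_distrib)
qed

lemma q_restrict: "q (restrict x I) = q x"
  by (simp add: q_def)

lemma q_measurable:
  assumes "\<And>i. i \<in> I \<Longrightarrow> g i \<in> borel_measurable N"
  shows "(\<lambda>\<omega>. q (\<lambda>i. g i \<omega>)) \<in> borel_measurable N"
  unfolding q_def using assms by simp

lemma q_measurable_L [measurable]: "q \<in> borel_measurable L"
  using q_measurable[of "\<lambda>i x. x i" L] by simp

lemma coord_measurable_exp_q: "coord_measurable (\<lambda>x. ennreal (exp (t * q x)))"
  by (auto simp: coord_measurable_def q_restrict)

lemma coord_measurable_w: "coord_measurable w"
  using coord_measurable_exp_q[of "-1"] by (simp add: w_def[abs_def])

lemma w_measurable [measurable]: "w \<in> borel_measurable L"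
  using coord_measurable_w by (simp add: coord_measurable_def)

lemma coord_measurable_mult:
  "coord_measurable f \<Longrightarrow> coord_measurable g \<Longrightarrow> coord_measurable (\<lambda>x. f x * g x)"
  by (auto simp: coord_measurable_def)

lemma rotation_w:
  assumes F: "coord_measurable2 F" and cs: "c\<^sup>2 + s\<^sup>2 = 1" and c: "0 < c"
  shows "(\<integral>\<^sup>+y. \<integral>\<^sup>+x. F (\<lambda>i. c * x i + s * y i) (\<lambda>i. s * x i - c * y i) * w x * w y \<partial>L \<partial>L)
       = (\<integral>\<^sup>+x. \<integral>\<^sup>+y. F x y * w x * w y \<partial>L \<partial>L)"
proof -
  have "coord_measurable2 (\<lambda>x y. F x y * w x * w y)"
    using F coord_measurable_w by (auto simp: coord_measurable2_def coord_measurable_def split_beta')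
  note R = rotation_L[OF this cs c]
  have "w (\<lambda>i. c * x i + s * y i) * w (\<lambda>i. s * x i - c * y i) = w x * w y" for x y
    using q_rotation[OF cs, of x y] unfolding w_def
    by (simp add: ennreal_mult'[symmetric] flip: exp_add)
  with R show ?thesis by (simp add: mult.assoc)
qed

section \<open>Anderson's inequality\<close>

text \<open>Bodies are sets of total functions that depend only on the coordinates in \<open>I\<close>, so that
  affine images need no restriction to \<open>I\<close>. Midpoint convexity is all that is used.\<close>

definition body :: "('i \<Rightarrow> real) set \<Rightarrow> bool" where
  "body K \<longleftrightarrow> K \<inter> space L \<in> sets L \<and> (\<forall>x. restrict x I \<in> K \<longleftrightarrow> x \<in> K) \<and>
     (\<forall>x\<in>K. (\<lambda>i. - x i) \<in> K) \<and> (\<forall>x\<in>K. \<forall>y\<in>K. (\<lambda>i. (x i + y i) / 2) \<in> K)"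

text \<open>Up to the factor \<open>1 / Z\<close>, the Gaussian measure of the translate K - a.
  Anderson's inequality only compares two such values, so the normalisation is postponed.\<close>

definition \<phi> :: "('i \<Rightarrow> real) set \<Rightarrow> ('i \<Rightarrow> real) \<Rightarrow> ennreal" where
  "\<phi> K a = (\<integral>\<^sup>+x. indicator K (\<lambda>i. x i + a i) * w x \<partial>L)"

lemma body_uminus: "body K \<Longrightarrow> x \<in> K \<Longrightarrow> (\<lambda>i. - x i) \<in> K"
  by (simp add: body_def)

lemma body_midpoint: "body K \<Longrightarrow> x \<in> K \<Longrightarrow> y \<in> K \<Longrightarrow> (\<lambda>i. (x i + y i) / 2) \<in> K"
  by (simp add: body_def)

lemma body_cong:
  assumes "body K" "\<And>i. i \<in> I \<Longrightarrow> x i = y i"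
  shows "x \<in> K \<longleftrightarrow> y \<in> K"
proof -
  have "restrict x I = restrict y I" using assms by auto
  then show ?thesis using assms(1) unfolding body_def by metis
qed

lemma coord_measurable_body: "body K \<Longrightarrow> coord_measurable (indicator K)"
  unfolding coord_measurable_def
  by (auto simp: body_def borel_measurable_indicator_iff) (auto simp: indicator_def)

lemma coord_measurable2_mult:
  "coord_measurable2 F \<Longrightarrow> coord_measurable2 G \<Longrightarrow> coord_measurable2 (\<lambda>x y. F x y * G x y)"
  by (auto simp: coord_measurable2_def split_beta')

lemma coord_measurable2_compI:
  assumes f: "coord_measurable f"
    and g: "\<And>i. i \<in> I \<Longrightarrow> (\<lambda>z. g i (fst z) (snd z)) \<in> borel_measurable (borel \<Otimes>\<^sub>M borel)"
  shows "coord_measurable2 (\<lambda>x y. f (\<lambda>i. g i (x i) (y i)))"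
  unfolding coord_measurable2_def
proof (intro conjI allI)
  have "(\<lambda>z. g i (fst z i) (snd z i)) \<in> borel_measurable (L \<Otimes>\<^sub>M L)" if "i \<in> I" for i
  proof -
    have "(\<lambda>z. (fst z i, snd z i)) \<in> L \<Otimes>\<^sub>M L \<rightarrow>\<^sub>M borel \<Otimes>\<^sub>M (borel :: real measure)"
      using that by measurable
    from measurable_compose[OF this g[OF that]] show ?thesis by simp
  qed
  from coord_measurable_comp[OF f, of "\<lambda>i z. g i (fst z i) (snd z i)", OF this]
  show "(\<lambda>(x, y). f (\<lambda>i. g i (x i) (y i))) \<in> borel_measurable (L \<Otimes>\<^sub>M L)"
    by (simp add: split_beta')
  fix x y :: "'i \<Rightarrow> real"
  have "f (restrict (\<lambda>i. g i (restrict x I i) (restrict y I i)) I) = f (restrict (\<lambda>i. g i (x i) (y i)) I)"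
    by (rule arg_cong[where f=f]) auto
  then show "f (\<lambda>i. g i (restrict x I i) (restrict y I i)) = f (\<lambda>i. g i (x i) (y i))"
    using f unfolding coord_measurable_def by metis
qed

lemma body_scale:
  assumes K: "body K"
  shows "body {x. (\<lambda>i. t * x i) \<in> K}"
  unfolding body_def
proof (intro conjI allI ballI)
  have "coord_measurable (\<lambda>x. indicator K (\<lambda>i. t * x i))"
    by (rule coord_measurable_compI[OF coord_measurable_body[OF K], of "\<lambda>i a. t * a"]) simp
  then have "(indicator {x. (\<lambda>i. t * x i) \<in> K} :: _ \<Rightarrow> ennreal) \<in> borel_measurable L"
    by (simp add: coord_measurable_def indicator_def[abs_def])
  then show "{x. (\<lambda>i. t * x i) \<in> K} \<inter> space L \<in> sets L"
    by (simp add: borel_measurable_indicator_iff)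
  show "restrict x I \<in> {x. (\<lambda>i. t * x i) \<in> K} \<longleftrightarrow> x \<in> {x. (\<lambda>i. t * x i) \<in> K}" for x
    unfolding mem_Collect_eq by (rule body_cong[OF K]) simp
  show "(\<lambda>i. - x i) \<in> {x. (\<lambda>i. t * x i) \<in> K}" if "x \<in> {x. (\<lambda>i. t * x i) \<in> K}" for x
    using body_uminus[OF K] that by simp
  show "(\<lambda>i. (x i + y i) / 2) \<in> {x. (\<lambda>i. t * x i) \<in> K}"
    if "x \<in> {x. (\<lambda>i. t * x i) \<in> K}" "y \<in> {x. (\<lambda>i. t * x i) \<in> K}" for x y
    using body_midpoint[OF K, of "\<lambda>i. t * x i" "\<lambda>i. t * y i"] that by (simp add: algebra_simps)
qed

text \<open>The slice at fixed u = (x + y) / sqrt 2 of the pairs with x and - y in K, read in the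
  variable z = (x - y) / sqrt 2: the two conditions are x = (z + u) / sqrt 2 and - y = (z - u) /
  sqrt 2.\<close>

definition section_body :: "('i \<Rightarrow> real) set \<Rightarrow> ('i \<Rightarrow> real) \<Rightarrow> ('i \<Rightarrow> real) set" where
  "section_body K u = {z. (\<lambda>i. (z i + u i) / sqrt 2) \<in> K \<and> (\<lambda>i. (z i - u i) / sqrt 2) \<in> K}"

text \<open>Negating z exchanges the two conditions, by the symmetry of K, so the slice is symmetric
  for every \<open>u\<close>. Being a body again is what lets the doubling step be iterated.\<close>

lemma body_section_body:
  assumes K: "body K"
  shows "body (section_body K u)"
  unfolding body_def
proof (intro conjI allI ballI)
  have "coord_measurable (\<lambda>x. indicator K (\<lambda>i. (x i + t * u i) / sqrt 2))" for t
    by (rule coord_measurable_compI[OF coord_measurable_body[OF K], of "\<lambda>i a. (a + t * u i) / sqrt 2"]) simp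
  from coord_measurable_mult[OF this this, of 1 "-1"]
  have "(\<lambda>x. indicator K (\<lambda>i. (x i + u i) / sqrt 2) * indicator K (\<lambda>i. (x i - u i) / sqrt 2) :: ennreal) \<in> borel_measurable L"
    by (simp add: coord_measurable_def)
  also have "(\<lambda>x. indicator K (\<lambda>i. (x i + u i) / sqrt 2) * indicator K (\<lambda>i. (x i - u i) / sqrt 2))
      = (indicator (section_body K u) :: _ \<Rightarrow> ennreal)"
    by (auto simp: section_body_def indicator_def fun_eq_iff)
  finally have "(indicator (section_body K u) :: _ \<Rightarrow> ennreal) \<in> borel_measurable L" .
  then show "section_body K u \<inter> space L \<in> sets L"
    by (simp add: borel_measurable_indicator_iff)
  show "restrict x I \<in> section_body K u \<longleftrightarrow> x \<in> section_body K u" for x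
    unfolding section_body_def mem_Collect_eq
    by (intro arg_cong2[where f="(\<and>)"] body_cong[OF K]) simp_all
  show "(\<lambda>i. - x i) \<in> section_body K u" if "x \<in> section_body K u" for x
  proof -
    have "(\<lambda>i. - ((x i + u i) / sqrt 2)) \<in> K" "(\<lambda>i. - ((x i - u i) / sqrt 2)) \<in> K"
      using that body_uminus[OF K] by (auto simp: section_body_def)
    moreover have "- ((a + b) / sqrt 2) = (- a - b) / sqrt 2" "- ((a - b) / sqrt 2) = (- a + b) / sqrt 2" for a b :: real
      by (simp_all add: field_simps)
    ultimately show ?thesis unfolding section_body_def by simp
  qed
  show "(\<lambda>i. (x i + y i) / 2) \<in> section_body K u"
    if "x \<in> section_body K u" "y \<in> section_body K u" for x y
  proof -
    have "(\<lambda>i. ((x i + u i) / sqrt 2 + (y i + u i) / sqrt 2) / 2) \<in> K"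
      "(\<lambda>i. ((x i - u i) / sqrt 2 + (y i - u i) / sqrt 2) / 2) \<in> K"
      using that by (auto simp: section_body_def intro!: body_midpoint[OF K])
    moreover have "((a + c) / sqrt 2 + (b + c) / sqrt 2) / 2 = ((a + b) / 2 + c) / sqrt 2"
      "((a - c) / sqrt 2 + (b - c) / sqrt 2) / 2 = ((a + b) / 2 - c) / sqrt 2" for a b c :: real
      by (simp_all add: field_simps)
    ultimately show ?thesis unfolding section_body_def by simp
  qed
qed

section \<open>Total mass and scaling of the weight\<close>

lemma nn_integral_w: "(\<integral>\<^sup>+x. w x \<partial>L) = ennreal (\<Prod>i\<in>I. sqrt (2 * pi * (\<sigma> i)\<^sup>2))"
proof -
  have one: "(\<integral>\<^sup>+x. ennreal (exp (- (x\<^sup>2 / (2 * (\<sigma> i)\<^sup>2)))) \<partial>lborel) = ennreal (sqrt (2 * pi * (\<sigma> i)\<^sup>2))"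
    if "i \<in> I" for i
  proof -
    let ?s = "sqrt (2 * pi * (\<sigma> i)\<^sup>2)"
    have s: "?s > 0" using \<sigma>_pos[OF that] by simp
    have "ennreal (exp (- (x\<^sup>2 / (2 * (\<sigma> i)\<^sup>2)))) = ennreal ?s * ennreal (normal_density 0 (\<sigma> i) x)" for x
      using s \<sigma>_pos[OF that] by (simp add: normal_density_def flip: ennreal_mult')
    moreover have "(\<integral>\<^sup>+x. ennreal (normal_density 0 (\<sigma> i) x) \<partial>lborel) = 1"
      using prob_space.emeasure_space_1[OF prob_space_normal_density[OF \<sigma>_pos[OF that], of 0]]
      by (simp add: emeasure_density)
    ultimately show ?thesis by (simp add: nn_integral_cmult)
  qed
  have "w x = (\<Prod>i\<in>I. ennreal (exp (- ((x i)\<^sup>2 / (2 * (\<sigma> i)\<^sup>2)))))" for x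
    by (simp add: w_def q_def prod_ennreal flip: exp_sum sum_negf)
  then have "(\<integral>\<^sup>+x. w x \<partial>L) = (\<Prod>i\<in>I. \<integral>\<^sup>+x. ennreal (exp (- (x\<^sup>2 / (2 * (\<sigma> i)\<^sup>2)))) \<partial>lborel)"
    unfolding L_def by (simp only:) (rule PL.product_nn_integral_prod; simp)
  also have "\<dots> = (\<Prod>i\<in>I. ennreal (sqrt (2 * pi * (\<sigma> i)\<^sup>2)))"
    by (intro prod.cong refl one)
  finally show ?thesis by (simp add: prod_ennreal)
qed

lemma \<phi>_measurable:
  assumes "body K" shows "(\<lambda>x. indicator K (\<lambda>i. x i + a i) :: ennreal) \<in> borel_measurable L"
  using coord_measurable_comp[OF coord_measurable_body[OF assms], of "\<lambda>i x. x i + a i" L] by simp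

lemma body_measurable [measurable]: "body K \<Longrightarrow> (indicator K :: _ \<Rightarrow> ennreal) \<in> borel_measurable L"
  using coord_measurable_body unfolding coord_measurable_def by blast

lemma \<phi>_finite: "\<phi> K a < \<infinity>"
proof -
  have "\<phi> K a \<le> (\<integral>\<^sup>+x. w x \<partial>L)"
    unfolding \<phi>_def by (intro nn_integral_mono) (simp add: indicator_def)
  then show ?thesis using nn_integral_w by (simp add: le_less_trans)
qed

text \<open>Enlarging K by the factor \<open>1 / t\<close> multiplies Lebesgue measure by
  \<open>(1 / t) ^ card I\<close>, and the weight at the stretched points is no larger because
  \<open>q\<close> grows. This is the source of the factor (1 - \<rho>^2)^(- d / 2) in the second
  moment.\<close>

lemma nn_integral_body_scale:
  assumes K: "body K" and t: "0 < t" "t \<le> 1"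
  shows "(\<integral>\<^sup>+x. indicator K (\<lambda>i. t * x i) * w x \<partial>L) \<le> ennreal ((1 / t) ^ card I) * (\<integral>\<^sup>+x. indicator K x * w x \<partial>L)"
proof -
  have "coord_measurable (\<lambda>x. indicator K (\<lambda>i. t * x i) * w x)"
    by (intro coord_measurable_mult coord_measurable_w
      coord_measurable_compI[OF coord_measurable_body[OF K], of "\<lambda>i a. t * a"]) simp
  from nn_integral_L_affine[OF this, of "1 / t" "\<lambda>_. 0"] t
  have "(\<integral>\<^sup>+x. indicator K (\<lambda>i. t * x i) * w x \<partial>L)
      = ennreal ((1 / t) ^ card I) * (\<integral>\<^sup>+x. indicator K x * w (\<lambda>i. 1 / t * x i) \<partial>L)"
    by simp
  also have "\<dots> \<le> ennreal ((1 / t) ^ card I) * (\<integral>\<^sup>+x. indicator K x * w x \<partial>L)"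
  proof (intro mult_left_mono nn_integral_mono)
    have "q x \<le> (1 / t)\<^sup>2 * q x" for x
    proof -
      have "1 \<le> (1 / t)\<^sup>2" using t by (intro one_le_power) simp
      then show ?thesis using mult_right_mono[OF _ q_nonneg[of x], of 1 "(1 / t)\<^sup>2"] by simp
    qed
    then show "w (\<lambda>i. 1 / t * x i) \<le> w x" for x
      unfolding w_def using q_scale[of "1 / t" x] by (simp add: ennreal_leI)
  qed simp_all
  finally show ?thesis .
qed

text \<open>The constant is irrelevant: the doubling argument takes roots of it. A point of
  \<open>K - b\<close> that almost minimises \<open>q\<close> replaces the metric projection of the origin.\<close>

lemma \<phi>_le_crude:
  assumes K: "body K"
  shows "\<phi> K b \<le> ennreal (exp 2 * 2 ^ card I) * \<phi> K (\<lambda>_. 0)"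
proof (cases "\<exists>x. (\<lambda>i. x i + b i) \<in> K")
  case False
  then show ?thesis by (simp add: \<phi>_def)
next
  case True
  define T where "T = q ` {x. (\<lambda>i. x i + b i) \<in> K}"
  have T: "T \<noteq> {}" "bdd_below T"
    using True q_nonneg by (auto simp: T_def intro!: bdd_belowI[of _ 0])
  obtain t where t: "t \<in> T" "t < Inf T + 1"
    using cInf_lessD[OF T(1), of "Inf T + 1"] by auto
  then obtain x0 where x0: "(\<lambda>i. x0 i + b i) \<in> K" "q x0 < Inf T + 1"
    by (auto simp: T_def)
  have min: "q x0 - 1 \<le> q x" if "(\<lambda>i. x i + b i) \<in> K" for x
    using cInf_lower[OF _ T(2), of "q x"] that x0(2) by (auto simp: T_def)
  define c where "c = (\<lambda>i. x0 i + b i)"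
  \<comment> \<open>The midpoint of x and \<open>x0\<close> is still admissible, so the
    parallelogram law turns near-minimality of \<open>q x0\<close>, with error 1, into quadratic
    growth around \<open>x0\<close>. The error becomes 2, whence the factor
    \<open>exp 2\<close>.\<close>
  have low: "q (\<lambda>i. x i - x0 i) / 2 - 2 \<le> q x" if x: "(\<lambda>i. x i + b i) \<in> K" for x
  proof -
    have "(\<lambda>i. ((x i + b i) + (x0 i + b i)) / 2) \<in> K"
      by (rule body_midpoint[OF K x x0(1)])
    moreover have "(\<lambda>i. ((x i + b i) + (x0 i + b i)) / 2) = (\<lambda>i. 1 / 2 * (x i + x0 i) + b i)"
      by (simp add: field_simps)
    ultimately have "(\<lambda>i. 1 / 2 * (x i + x0 i) + b i) \<in> K" by metis
    then have "q x0 - 1 \<le> q (\<lambda>i. 1 / 2 * (x i + x0 i))"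
      by (rule min)
    also have "\<dots> = q (\<lambda>i. x i + x0 i) / 4"
      unfolding q_scale by (simp add: power2_eq_square)
    finally show ?thesis using q_parallelogram[of x x0] q_nonneg[of x0] by simp
  qed
  have "\<phi> K b \<le> (\<integral>\<^sup>+x. indicator K (\<lambda>i. x i + b i) * (ennreal (exp 2) * ennreal (exp (- q (\<lambda>i. x i - x0 i) / 2))) \<partial>L)"
    unfolding \<phi>_def
  proof (intro nn_integral_mono)
    fix x
    have "w x \<le> ennreal (exp 2) * ennreal (exp (- q (\<lambda>i. x i - x0 i) / 2))" if "(\<lambda>i. x i + b i) \<in> K"
    proof -
      have "exp (- q x) \<le> exp (2 + - q (\<lambda>i. x i - x0 i) / 2)" using low[OF that] by simp
      then show ?thesis unfolding w_def exp_add by (subst ennreal_mult[symmetric]) (auto intro: ennreal_leI)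
    qed
    then show "indicator K (\<lambda>i. x i + b i) * w x
        \<le> indicator K (\<lambda>i. x i + b i) * (ennreal (exp 2) * ennreal (exp (- q (\<lambda>i. x i - x0 i) / 2)))"
      by (simp add: indicator_def)
  qed
  also have "\<dots> = (\<integral>\<^sup>+x. indicator K (\<lambda>i. x i + c i) * (ennreal (exp 2) * ennreal (exp (- q x / 2))) \<partial>L)"
  proof -
    have "coord_measurable (\<lambda>x. indicator K (\<lambda>i. x i + b i) * (ennreal (exp 2) * ennreal (exp (- (1 / 2) * q (\<lambda>i. x i - x0 i)))))"
    proof (intro coord_measurable_mult)
      show "coord_measurable (\<lambda>x. indicator K (\<lambda>i. x i + b i))"
        by (rule coord_measurable_compI[OF coord_measurable_body[OF K], of "\<lambda>i a. a + b i"]) simp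
      show "coord_measurable (\<lambda>x. ennreal (exp (- (1 / 2) * q (\<lambda>i. x i - x0 i))))"
        by (rule coord_measurable_compI[OF coord_measurable_exp_q, of "\<lambda>i a. a - x0 i"]) simp
    qed (simp add: coord_measurable_def)
    from nn_integral_L_affine[OF this, of 1 "x0"] show ?thesis
      by (simp add: c_def algebra_simps)
  qed
  \<comment> \<open>Both x + c and - c lie in K, and their midpoint is x / 2. The translate is thus
    absorbed by the doubled body. Rescaling then costs \<open>2 ^ card I\<close> and turns half of
    \<open>q\<close> into twice \<open>q\<close>, which is at least \<open>q\<close>.\<close>
  also have "\<dots> \<le> (\<integral>\<^sup>+x. ennreal (exp 2) * (indicator K (\<lambda>i. 1 / 2 * x i) * ennreal (exp (- q x / 2))) \<partial>L)"
  proof (intro nn_integral_mono)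
    fix x
    have "(\<lambda>i. 1 / 2 * x i) \<in> K" if "(\<lambda>i. x i + c i) \<in> K"
      using body_midpoint[OF K that body_uminus[OF K x0(1)]] by (simp add: c_def)
    then show "indicator K (\<lambda>i. x i + c i) * (ennreal (exp 2) * ennreal (exp (- q x / 2)))
      \<le> ennreal (exp 2) * (indicator K (\<lambda>i. 1 / 2 * x i) * ennreal (exp (- q x / 2)))"
      by (auto simp: indicator_def)
  qed
  also have "\<dots> = ennreal (exp 2) * (\<integral>\<^sup>+x. indicator K (\<lambda>i. 1 / 2 * x i) * ennreal (exp (- (1 / 2) * q x)) \<partial>L)"
    using coord_measurable_comp[OF coord_measurable_body[OF K], of "\<lambda>i x. 1 / 2 * x i" L]
    by (subst nn_integral_cmult) auto
  also have "(\<integral>\<^sup>+x. indicator K (\<lambda>i. 1 / 2 * x i) * ennreal (exp (- (1 / 2) * q x)) \<partial>L)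
      = ennreal (2 ^ card I) * (\<integral>\<^sup>+x. indicator K x * ennreal (exp (- (1 / 2) * q (\<lambda>i. 2 * x i))) \<partial>L)"
  proof -
    have "coord_measurable (\<lambda>x. indicator K (\<lambda>i. 1 / 2 * x i) * ennreal (exp (- (1 / 2) * q x)))"
      by (intro coord_measurable_mult coord_measurable_exp_q
          coord_measurable_compI[OF coord_measurable_body[OF K], of "\<lambda>i a. 1 / 2 * a"]) simp
    from nn_integral_L_affine[OF this, of 2 "\<lambda>_. 0"] show ?thesis by simp
  qed
  also have "(\<integral>\<^sup>+x. indicator K x * ennreal (exp (- (1 / 2) * q (\<lambda>i. 2 * x i))) \<partial>L) \<le> \<phi> K (\<lambda>_. 0)"
    unfolding \<phi>_def
    by (intro nn_integral_mono mult_mono) (auto simp: w_def q_scale q_nonneg intro!: ennreal_leI)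
  finally show ?thesis
    by (simp add: ennreal_mult' mult.assoc mult_left_mono)
qed

text \<open>For independent copies x and y the left side is the joint weight of x + a in K and - y +
  a in K; the sign is free because \<open>w\<close> is even. In the rotated variables u and z of
  \<open>section_body\<close>, the reflected sign puts the whole shift, sqrt 2 times a, into z and
  none into u.\<close>

lemma \<phi>_square:
  assumes K: "body K"
  shows "\<phi> K a * \<phi> K a = (\<integral>\<^sup>+u. \<phi> (section_body K u) (\<lambda>i. sqrt 2 * a i) * w u \<partial>L)"
proof -
  let ?c = "1 / sqrt 2"
  define F :: "('i \<Rightarrow> real) \<Rightarrow> ('i \<Rightarrow> real) \<Rightarrow> ennreal" where
    "F u z = indicator K (\<lambda>i. (u i + z i) / sqrt 2 + a i) * indicator K (\<lambda>i. - ((u i - z i) / sqrt 2) + a i)" for u z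
  have F: "coord_measurable2 F"
    unfolding F_def
    by (intro coord_measurable2_mult
        coord_measurable2_compI[OF coord_measurable_body[OF K], of "\<lambda>i u z. (u + z) / sqrt 2 + a i"]
        coord_measurable2_compI[OF coord_measurable_body[OF K], of "\<lambda>i u z. - ((u - z) / sqrt 2) + a i"]) simp_all
  have neg: "(\<integral>\<^sup>+y. indicator K (\<lambda>i. - y i + a i) * w y \<partial>L) = \<phi> K a"
  proof -
    have "coord_measurable (\<lambda>x. indicator K (\<lambda>i. x i + a i) * w x)"
      by (intro coord_measurable_mult coord_measurable_w
        coord_measurable_compI[OF coord_measurable_body[OF K], of "\<lambda>i x. x + a i"]) simp
    from nn_integral_L_affine[OF this, of "-1" "\<lambda>_. 0"] show ?thesis
      using q_scale[of "-1"] by (simp add: \<phi>_def w_def)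
  qed
  have meas: "(\<lambda>x. indicator K (\<lambda>i. - x i + a i) :: ennreal) \<in> borel_measurable L"
    using coord_measurable_comp[OF coord_measurable_body[OF K], of "\<lambda>i x. - x i + a i" L] by simp
  have "\<phi> K a * \<phi> K a = (\<integral>\<^sup>+y. \<integral>\<^sup>+x. indicator K (\<lambda>i. x i + a i) * indicator K (\<lambda>i. - y i + a i) * w x * w y \<partial>L \<partial>L)"
  proof -
    have "(\<integral>\<^sup>+x. indicator K (\<lambda>i. x i + a i) * indicator K (\<lambda>i. - y i + a i) * w x * w y \<partial>L)
       = \<phi> K a * (indicator K (\<lambda>i. - y i + a i) * w y)" for y
      unfolding \<phi>_def using \<phi>_measurable[OF K, of a]
      by (subst nn_integral_multc[symmetric]) (auto intro!: nn_integral_cong simp: mult_ac)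
    then show ?thesis
      using meas by (simp only: nn_integral_cmult neg borel_measurable_times_ennreal w_measurable)
  qed
  also have "\<dots> = (\<integral>\<^sup>+y. \<integral>\<^sup>+x. F (\<lambda>i. ?c * x i + ?c * y i) (\<lambda>i. ?c * x i - ?c * y i) * w x * w y \<partial>L \<partial>L)"
  proof -
    have "(?c * x + ?c * y + (?c * x - ?c * y)) / sqrt 2 = x" "(?c * x + ?c * y - (?c * x - ?c * y)) / sqrt 2 = y" for x y :: real
      by (simp_all add: field_simps)
    then show ?thesis unfolding F_def by simp
  qed
  also have "\<dots> = (\<integral>\<^sup>+u. \<integral>\<^sup>+z. F u z * w u * w z \<partial>L \<partial>L)"
    by (rule rotation_w[OF F]) (simp_all add: power_divide)
  also have "\<dots> = (\<integral>\<^sup>+u. \<phi> (section_body K u) (\<lambda>i. sqrt 2 * a i) * w u \<partial>L)"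
  proof (rule nn_integral_cong)
    fix u
    have F_eq: "F u z = indicator (section_body K u) (\<lambda>i. z i + sqrt 2 * a i)" for z
    proof -
      have "(u' + z') / sqrt 2 + a' = (z' + sqrt 2 * a' + u') / sqrt 2"
        "- ((u' - z') / sqrt 2) + a' = (z' + sqrt 2 * a' - u') / sqrt 2" for u' z' a' :: real
        by (simp_all add: field_simps)
      then show ?thesis by (simp add: F_def section_body_def indicator_def)
    qed
    show "(\<integral>\<^sup>+z. F u z * w u * w z \<partial>L) = \<phi> (section_body K u) (\<lambda>i. sqrt 2 * a i) * w u"
      unfolding F_eq \<phi>_def using \<phi>_measurable[OF body_section_body[OF K, of u], of "\<lambda>i. sqrt 2 * a i"]
      by (subst nn_integral_multc[symmetric]) (auto intro!: nn_integral_cong simp: mult_ac)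
  qed
  finally show ?thesis .
qed

lemma \<phi>_section_measurable:
  assumes K: "body K"
  shows "(\<lambda>u. \<phi> (section_body K u) a) \<in> borel_measurable L"
proof -
  have cm: "coord_measurable2 (\<lambda>u z. indicator K (\<lambda>i. (z i + a i + u i) / sqrt 2) * indicator K (\<lambda>i. (z i + a i - u i) / sqrt 2))"
    by (intro coord_measurable2_mult
        coord_measurable2_compI[OF coord_measurable_body[OF K], of "\<lambda>i u z. (z + a i + u) / sqrt 2"]
        coord_measurable2_compI[OF coord_measurable_body[OF K], of "\<lambda>i u z. (z + a i - u) / sqrt 2"]) simp_all
  have [measurable]: "(\<lambda>(u, z). indicator (section_body K u) (\<lambda>i. z i + a i) :: ennreal) \<in> borel_measurable (L \<Otimes>\<^sub>M L)"
  proof -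
    have "(indicator (section_body K u) (\<lambda>i. z i + a i) :: ennreal)
      = indicator K (\<lambda>i. (z i + a i + u i) / sqrt 2) * indicator K (\<lambda>i. (z i + a i - u i) / sqrt 2)" for u z
      by (simp add: section_body_def indicator_def)
    then show ?thesis using cm by (simp add: coord_measurable2_def)
  qed
  show ?thesis unfolding \<phi>_def
    by (rule sigma_finite_measure.borel_measurable_nn_integral[OF sigma_finite_L]) measurable
qed

text \<open>A bound with constant R on all slices gives, through \<open>\<phi>_square\<close>, the
  inequality between squares with the same R, hence between the values with sqrt R. The body and the
  shift both change on the way, so the induction covers all of them at once.\<close>

lemma \<phi>_le_root:
  assumes "body K"
  shows "\<phi> K a \<le> ennreal (root (2 ^ k) (exp 2 * 2 ^ card I)) * \<phi> K (\<lambda>_. 0)"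
  using assms
proof (induction k arbitrary: K a)
  case 0
  then show ?case using \<phi>_le_crude by simp
next
  case (Suc k)
  define R where "R = root (2 ^ k) (exp 2 * 2 ^ card I :: real)"
  have R: "R \<ge> 0" by (simp add: R_def)
  have sq: "root (2 ^ Suc k) (exp 2 * 2 ^ card I :: real) = sqrt R"
    unfolding R_def sqrt_def by (simp add: real_root_mult_exp)
  have "\<phi> K a * \<phi> K a = (\<integral>\<^sup>+u. \<phi> (section_body K u) (\<lambda>i. sqrt 2 * a i) * w u \<partial>L)"
    by (rule \<phi>_square[OF Suc.prems])
  also have "\<dots> \<le> (\<integral>\<^sup>+u. ennreal R * (\<phi> (section_body K u) (\<lambda>i. sqrt 2 * 0) * w u) \<partial>L)"
    using Suc.IH[OF body_section_body[OF Suc.prems], folded R_def]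
    by (intro nn_integral_mono) (simp flip: mult.assoc add: mult_right_mono)
  also have "\<dots> = ennreal R * (\<phi> K (\<lambda>_. 0) * \<phi> K (\<lambda>_. 0))"
    unfolding \<phi>_square[OF Suc.prems]
    using \<phi>_section_measurable[OF Suc.prems] by (intro nn_integral_cmult) simp
  finally have le: "\<phi> K a * \<phi> K a \<le> ennreal R * (\<phi> K (\<lambda>_. 0) * \<phi> K (\<lambda>_. 0))" .
  obtain p r where pr: "\<phi> K a = ennreal p" "\<phi> K (\<lambda>_. 0) = ennreal r" "p \<ge> 0" "r \<ge> 0"
    using \<phi>_finite[of K a] \<phi>_finite[of K "\<lambda>_. 0"] by (cases "\<phi> K a"; cases "\<phi> K (\<lambda>_. 0)") auto
  have "p * p \<le> R * (r * r)"
    using le R pr by (simp flip: ennreal_mult)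
  then have "p\<^sup>2 \<le> (sqrt R * r)\<^sup>2"
    using R by (simp add: power_mult_distrib) (simp add: power2_eq_square)
  then have "p \<le> sqrt R * r" by (rule power2_le_imp_le) (use R pr(4) in simp)
  then have "ennreal p \<le> ennreal (sqrt R) * ennreal r"
    using R pr(4) by (subst ennreal_mult[symmetric]) (simp_all add: ennreal_leI)
  then show ?case unfolding sq by (simp only: pr)
qed

text \<open>The iterated roots of the crude constant tend to 1, and finiteness of
  \<open>\<phi>\<close> lets the limit pass through the product.\<close>

theorem anderson:
  assumes "body K"
  shows "\<phi> K a \<le> \<phi> K (\<lambda>_. 0)"
proof -
  have "(\<lambda>k. root (2 ^ k) (exp 2 * 2 ^ card I :: real)) \<longlonglongrightarrow> 1"
  proof -
    have "filterlim (\<lambda>k::nat. (2::nat) ^ k) at_top at_top"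
      by (rule filterlim_subseq) (simp add: strict_mono_def)
    from filterlim_compose[OF LIMSEQ_root_const this, of "exp 2 * 2 ^ card I"]
    show ?thesis by (simp add: o_def)
  qed
  then have "(\<lambda>k. ennreal (root (2 ^ k) (exp 2 * 2 ^ card I)) * \<phi> K (\<lambda>_. 0)) \<longlonglongrightarrow> ennreal 1 * \<phi> K (\<lambda>_. 0)"
    using \<phi>_finite[of K "\<lambda>_. 0"] by (intro tendsto_mult_ennreal tendsto_const tendsto_ennrealI) auto
  then show ?thesis
    using LIMSEQ_le_const[of _ "ennreal 1 * \<phi> K (\<lambda>_. 0)" "\<phi> K a"] \<phi>_le_root[OF assms] by auto
qed

text \<open>For fixed x the section in y is the body K / \<tau> translated by - (\<rho> / \<tau>) x.
  Anderson's inequality removes the translation uniformly in x, and the scaling bound trades K /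
  \<tau> for K, so the double integral decouples.\<close>

lemma correlated_pair_le:
  assumes K: "body K" and \<tau>: "0 < \<tau>" "\<tau> \<le> 1"
  shows "(\<integral>\<^sup>+x. \<integral>\<^sup>+y. indicator K x * indicator K (\<lambda>i. \<rho> * x i + \<tau> * y i) * w x * w y \<partial>L \<partial>L)
     \<le> ennreal ((1 / \<tau>) ^ card I) * (\<phi> K (\<lambda>_. 0) * \<phi> K (\<lambda>_. 0))"
proof -
  let ?K' = "{x. (\<lambda>i. \<tau> * x i) \<in> K}"
  let ?p = "\<phi> K (\<lambda>_. 0)"
  have K': "body ?K'" by (rule body_scale[OF K])
  have inner: "(\<integral>\<^sup>+y. indicator K (\<lambda>i. \<rho> * x i + \<tau> * y i) * w y \<partial>L) \<le> ennreal ((1 / \<tau>) ^ card I) * ?p" for x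
  proof -
    have "(\<integral>\<^sup>+y. indicator K (\<lambda>i. \<rho> * x i + \<tau> * y i) * w y \<partial>L) = \<phi> ?K' (\<lambda>i. \<rho> / \<tau> * x i)"
    proof -
      have "\<tau> * (b + \<rho> / \<tau> * a) = \<rho> * a + \<tau> * b" for a b
        using \<tau> by (simp add: field_simps)
      then show ?thesis unfolding \<phi>_def by (simp add: indicator_def)
    qed
    also have "\<dots> \<le> \<phi> ?K' (\<lambda>_. 0)" by (rule anderson[OF K'])
    also have "\<dots> = (\<integral>\<^sup>+x. indicator K (\<lambda>i. \<tau> * x i) * w x \<partial>L)"
      by (simp add: \<phi>_def indicator_def)
    also have "\<dots> \<le> ennreal ((1 / \<tau>) ^ card I) * ?p"
      using nn_integral_body_scale[OF K \<tau>] by (simp add: \<phi>_def)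
    finally show ?thesis .
  qed
  have "(\<integral>\<^sup>+y. indicator K x * indicator K (\<lambda>i. \<rho> * x i + \<tau> * y i) * w x * w y \<partial>L)
      = (indicator K x * w x) * (\<integral>\<^sup>+y. indicator K (\<lambda>i. \<rho> * x i + \<tau> * y i) * w y \<partial>L)" for x
    using coord_measurable_comp[OF coord_measurable_body[OF K], of "\<lambda>i y. \<rho> * x i + \<tau> * y i" L]
    by (subst nn_integral_cmult[symmetric]) (auto intro!: nn_integral_cong simp: mult_ac)
  then have "(\<integral>\<^sup>+x. \<integral>\<^sup>+y. indicator K x * indicator K (\<lambda>i. \<rho> * x i + \<tau> * y i) * w x * w y \<partial>L \<partial>L)
     \<le> (\<integral>\<^sup>+x. (indicator K x * w x) * (ennreal ((1 / \<tau>) ^ card I) * ?p) \<partial>L)"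
    using inner by (auto intro!: nn_integral_mono mult_left_mono)
  also have "\<dots> = ?p * (ennreal ((1 / \<tau>) ^ card I) * ?p)"
    using body_measurable[OF K] by (subst nn_integral_multc) (simp_all add: \<phi>_def)
  finally show ?thesis by (simp add: mult_ac)
qed

section \<open>Independent normal coordinates and signed sums\<close>

abbreviation normal_coord :: "'i \<Rightarrow> real measure" where
  "normal_coord i \<equiv> density lborel (normal_density 0 (\<sigma> i))"

definition G :: "('i \<Rightarrow> real) measure" where
  "G = PiM I normal_coord"

definition Z :: real where
  "Z = (\<Prod>i\<in>I. sqrt (2 * pi * (\<sigma> i)\<^sup>2))"

lemma Z_pos: "0 < Z"
  unfolding Z_def using \<sigma>_pos by (intro prod_pos) (simp add: less_imp_neq[symmetric])

lemma sets_G [measurable_cong, simp]: "sets G = sets L"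
  unfolding G_def L_def by (intro sets_PiM_cong) auto

lemma space_G [simp]: "space G = space L"
  by (rule sets_eq_imp_space_eq) simp

lemma prod_normal_density:
  "(\<Prod>i\<in>I. ennreal (normal_density 0 (\<sigma> i) (x i))) = ennreal (1 / Z) * w x"
proof -
  have "(\<Prod>i\<in>I. normal_density 0 (\<sigma> i) (x i)) = 1 / Z * exp (- q x)"
    by (simp add: normal_density_def prod.distrib Z_def q_def prod_dividef flip: exp_sum sum_negf)
  then show ?thesis
    using Z_pos by (simp add: prod_ennreal w_def flip: ennreal_mult)
qed

lemma G_density: "G = density L (\<lambda>x. ennreal (1 / Z) * w x)"
proof -
  \<comment> \<open>Positivity of \<open>\<sigma>\<close> is known on \<open>I\<close> only, while
    the product locale asks for a sigma-finite factor at every index; \<open>lborel\<close> fills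
    the rest.\<close>
  interpret N: product_sigma_finite "\<lambda>i. if i \<in> I then normal_coord i else lborel"
    by (rule product_sigma_finite.intro)
      (auto intro: prob_space_imp_sigma_finite[OF prob_space_normal_density] \<sigma>_pos lborel.sigma_finite_measure_axioms)
  have "density L (\<lambda>x. ennreal (1 / Z) * w x) = PiM I (\<lambda>i. if i \<in> I then normal_coord i else lborel)"
  proof (rule N.PiM_eqI)
    show "sets (density L (\<lambda>x. ennreal (1 / Z) * w x)) = sets (PiM I (\<lambda>i. if i \<in> I then normal_coord i else lborel))"
      unfolding L_def sets_density by (intro sets_PiM_cong) auto
    fix A :: "'i \<Rightarrow> real set"
    assume A: "\<And>i. i \<in> I \<Longrightarrow> A i \<in> sets (if i \<in> I then normal_coord i else lborel)"
    have A': "A i \<in> sets borel" if "i \<in> I" for i using A[OF that] that by simp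
    have PA: "PiE I A \<in> sets L" unfolding L_def using A' by (intro sets_PiM_I_finite) auto
    have "emeasure (density L (\<lambda>x. ennreal (1 / Z) * w x)) (PiE I A)
      = (\<integral>\<^sup>+x. (\<Prod>i\<in>I. ennreal (normal_density 0 (\<sigma> i) (x i)) * indicator (A i) (x i)) \<partial>L)"
    proof (subst emeasure_density[OF _ PA], measurable, rule nn_integral_cong)
      fix x assume "x \<in> space L"
      then have "(indicator (PiE I A) x :: ennreal) = (\<Prod>i\<in>I. indicator (A i) (x i))"
        by (auto simp: L_def space_PiM PiE_def Pi_def indicator_def)
      then show "ennreal (1 / Z) * w x * indicator (PiE I A) x
          = (\<Prod>i\<in>I. ennreal (normal_density 0 (\<sigma> i) (x i)) * indicator (A i) (x i))"
        by (simp add: prod.distrib prod_normal_density)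
    qed
    also have "\<dots> = (\<Prod>i\<in>I. \<integral>\<^sup>+x. ennreal (normal_density 0 (\<sigma> i) x) * indicator (A i) x \<partial>lborel)"
      unfolding L_def using A' by (intro PL.product_nn_integral_prod) auto
    also have "\<dots> = (\<Prod>i\<in>I. emeasure (if i \<in> I then normal_coord i else lborel) (A i))"
      using A' by (intro prod.cong refl) (simp add: emeasure_density)
    finally show "emeasure (density L (\<lambda>x. ennreal (1 / Z) * w x)) (PiE I A)
      = (\<Prod>i\<in>I. emeasure (if i \<in> I then normal_coord i else lborel) (A i))" .
  qed simp
  also have "\<dots> = G"
    unfolding G_def by (intro PiM_cong) auto
  finally show ?thesis by simp
qed

lemma prob_space_G: "prob_space G"
  unfolding G_def by (intro prob_space_PiM prob_space_normal_density \<sigma>_pos)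

sublocale GG: pair_sigma_finite G G
  by (intro pair_sigma_finite.intro prob_space_imp_sigma_finite prob_space_G)

lemma emeasure_G_body:
  assumes K: "body K"
  shows "emeasure G (K \<inter> space L) = ennreal (1 / Z) * \<phi> K (\<lambda>_. 0)"
proof -
  have "emeasure G (K \<inter> space L) = (\<integral>\<^sup>+x. ennreal (1 / Z) * (indicator K x * w x) \<partial>L)"
    unfolding G_density using K
    by (subst emeasure_density) (auto simp: body_def indicator_def intro!: nn_integral_cong)
  also have "\<dots> = ennreal (1 / Z) * \<phi> K (\<lambda>_. 0)"
    using body_measurable[OF K] by (simp add: nn_integral_cmult \<phi>_def)
  finally show ?thesis .
qed

text \<open>Substituting g x for x gives the volume factor \<open>g ^ card I\<close>, and the weight
  drops by exp (- (g^2 - 1) q x), which on K is at worst the stated exponential. When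
  \<open>B\<close> is small against \<open>card I\<close>, dilation gains almost the full volume
  factor.\<close>

lemma emeasure_G_dilate:
  assumes K: "body K" and g: "1 \<le> g" and B: "\<And>x. x \<in> K \<Longrightarrow> q x \<le> B"
  shows "ennreal (g ^ card I * exp (- ((g\<^sup>2 - 1) * B))) * emeasure G (K \<inter> space L)
     \<le> emeasure G ({x. (\<lambda>i. 1 / g * x i) \<in> K} \<inter> space L)"
proof -
  let ?E = "ennreal (exp (- ((g\<^sup>2 - 1) * B)))"
  have "coord_measurable (\<lambda>x. indicator K (\<lambda>i. 1 / g * x i) * w x)"
    by (intro coord_measurable_mult coord_measurable_w
      coord_measurable_compI[OF coord_measurable_body[OF K], of "\<lambda>i a. 1 / g * a"]) simp
  from nn_integral_L_affine[OF this, of g "\<lambda>_. 0"] g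
  have scale: "\<phi> {x. (\<lambda>i. 1 / g * x i) \<in> K} (\<lambda>_. 0)
      = ennreal (g ^ card I) * (\<integral>\<^sup>+x. indicator K x * w (\<lambda>i. g * x i) \<partial>L)"
    by (simp add: \<phi>_def indicator_def)
  have "?E * \<phi> K (\<lambda>_. 0) = (\<integral>\<^sup>+x. ?E * (indicator K x * w x) \<partial>L)"
    using body_measurable[OF K] by (simp add: \<phi>_def nn_integral_cmult)
  also have "\<dots> \<le> (\<integral>\<^sup>+x. indicator K x * w (\<lambda>i. g * x i) \<partial>L)"
  proof (rule nn_integral_mono)
    fix x
    have "?E * w x \<le> w (\<lambda>i. g * x i)" if "x \<in> K"
    proof -
      have "(g\<^sup>2 - 1) * q x \<le> (g\<^sup>2 - 1) * B"
        using g B[OF that] by (intro mult_left_mono) simp_all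
      then have "exp (- ((g\<^sup>2 - 1) * B)) * exp (- q x) \<le> exp (- q (\<lambda>i. g * x i))"
        by (simp add: q_scale algebra_simps flip: exp_add)
      then show ?thesis
        unfolding w_def by (subst ennreal_mult[symmetric]) (auto intro: ennreal_leI)
    qed
    then show "?E * (indicator K x * w x) \<le> indicator K x * w (\<lambda>i. g * x i)"
      by (simp add: indicator_def)
  qed
  finally have "ennreal (g ^ card I) * (?E * \<phi> K (\<lambda>_. 0)) \<le> \<phi> {x. (\<lambda>i. 1 / g * x i) \<in> K} (\<lambda>_. 0)"
    unfolding scale by (rule mult_left_mono) simp
  then have "ennreal (1 / Z) * (ennreal (g ^ card I) * (?E * \<phi> K (\<lambda>_. 0)))
      \<le> ennreal (1 / Z) * \<phi> {x. (\<lambda>i. 1 / g * x i) \<in> K} (\<lambda>_. 0)"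
    by (rule mult_left_mono) simp
  then show ?thesis
    unfolding emeasure_G_body[OF K] emeasure_G_body[OF body_scale[OF K]]
    using g by (simp add: ennreal_mult mult_ac)
qed

text \<open>For independent x and y the two combinations have correlation \<rho> = c^2 - s^2. With
  \<tau> = 2 c s one has \<rho>^2 + \<tau>^2 = 1, and the rotation turns them into X and \<rho> X +
  \<tau> Y with X and Y independent, the form treated in \<open>correlated_pair_le\<close>.\<close>

lemma rotated_pair_le:
  assumes K: "body K" and cs: "0 < c" "0 < s" "c\<^sup>2 + s\<^sup>2 = 1"
  shows "(\<integral>\<^sup>+y. \<integral>\<^sup>+x. indicator K (\<lambda>i. c * x i + s * y i) * indicator K (\<lambda>i. c * x i - s * y i) \<partial>G \<partial>G)
     \<le> ennreal ((1 / (2 * c * s)) ^ card I) * (emeasure G (K \<inter> space L) * emeasure G (K \<inter> space L))"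
proof -
  let ?\<tau> = "2 * c * s" and ?\<rho> = "c\<^sup>2 - s\<^sup>2" and ?z = "ennreal (1 / Z)"
  define F :: "('i \<Rightarrow> real) \<Rightarrow> ('i \<Rightarrow> real) \<Rightarrow> ennreal" where
    "F x y = indicator K x * indicator K (\<lambda>i. ?\<rho> * x i + ?\<tau> * y i)" for x y
  have F: "coord_measurable2 F"
    unfolding F_def
    by (intro coord_measurable2_mult
        coord_measurable2_compI[OF coord_measurable_body[OF K], of "\<lambda>i x y. x"]
        coord_measurable2_compI[OF coord_measurable_body[OF K], of "\<lambda>i x y. ?\<rho> * x + ?\<tau> * y"]) simp_all
  have F_eq: "F (\<lambda>i. c * x i + s * y i) (\<lambda>i. s * x i - c * y i)
      = indicator K (\<lambda>i. c * x i + s * y i) * indicator K (\<lambda>i. c * x i - s * y i)" for x y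
  proof -
    have "?\<rho> * (c * a + s * b) + ?\<tau> * (s * a - c * b) = (c\<^sup>2 + s\<^sup>2) * (c * a - s * b)" for a b
      by (simp add: power2_eq_square algebra_simps)
    then show ?thesis unfolding F_def cs(3) by simp
  qed
  have \<tau>: "0 < ?\<tau>" "?\<tau> \<le> 1"
    using cs sum_squares_bound[of c s] by simp_all
  have m: "(\<lambda>x. F (\<lambda>i. c * x i + s * y i) (\<lambda>i. s * x i - c * y i)) \<in> borel_measurable L" for y
    using coord_measurable2_comp[OF F, of "\<lambda>i x. c * x i + s * y i" L "\<lambda>i x. s * x i - c * y i"] by simp
  have m2: "(\<lambda>(y, x). F (\<lambda>i. c * x i + s * y i) (\<lambda>i. s * x i - c * y i)) \<in> borel_measurable (L \<Otimes>\<^sub>M L)"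
    using coord_measurable2_comp[OF F, of "\<lambda>i z. c * snd z i + s * fst z i" "L \<Otimes>\<^sub>M L" "\<lambda>i z. s * snd z i - c * fst z i"]
    by (simp add: split_beta')
  have "(\<lambda>(y, x). F (\<lambda>i. c * x i + s * y i) (\<lambda>i. s * x i - c * y i) * w x * w y) \<in> borel_measurable (L \<Otimes>\<^sub>M L)"
    using m2 by (simp add: split_beta')
  from sigma_finite_measure.borel_measurable_nn_integral[OF sigma_finite_L this]
  have m3: "(\<lambda>y. \<integral>\<^sup>+x. F (\<lambda>i. c * x i + s * y i) (\<lambda>i. s * x i - c * y i) * w x * w y \<partial>L) \<in> borel_measurable L" .
  have m4: "(\<lambda>y. \<integral>\<^sup>+x. F (\<lambda>i. c * x i + s * y i) (\<lambda>i. s * x i - c * y i) \<partial>G) \<in> borel_measurable L"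
  proof -
    have "(\<lambda>y. \<integral>\<^sup>+x. F (\<lambda>i. c * x i + s * y i) (\<lambda>i. s * x i - c * y i) \<partial>G) \<in> borel_measurable G"
      by (rule sigma_finite_measure.borel_measurable_nn_integral[OF prob_space_imp_sigma_finite[OF prob_space_G]])
        (use m2 in \<open>simp cong: measurable_cong_sets sets_pair_measure_cong\<close>)
    then show ?thesis by simp
  qed
  have "(\<integral>\<^sup>+y. \<integral>\<^sup>+x. indicator K (\<lambda>i. c * x i + s * y i) * indicator K (\<lambda>i. c * x i - s * y i) \<partial>G \<partial>G)
     = (\<integral>\<^sup>+y. \<integral>\<^sup>+x. F (\<lambda>i. c * x i + s * y i) (\<lambda>i. s * x i - c * y i) \<partial>G \<partial>G)"
    by (simp add: F_eq)
  also have "\<dots> = (\<integral>\<^sup>+y. (?z * w y) * (\<integral>\<^sup>+x. F (\<lambda>i. c * x i + s * y i) (\<lambda>i. s * x i - c * y i) \<partial>G) \<partial>L)"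
    by (subst G_density, subst nn_integral_density) (use m4 in simp_all)
  also have "\<dots> = (\<integral>\<^sup>+y. ?z * ?z * (\<integral>\<^sup>+x. F (\<lambda>i. c * x i + s * y i) (\<lambda>i. s * x i - c * y i) * w x * w y \<partial>L) \<partial>L)"
  proof (rule nn_integral_cong)
    fix y
    have "(?z * w y) * (\<integral>\<^sup>+x. F (\<lambda>i. c * x i + s * y i) (\<lambda>i. s * x i - c * y i) \<partial>G)
       = (?z * w y) * (\<integral>\<^sup>+x. ?z * w x * F (\<lambda>i. c * x i + s * y i) (\<lambda>i. s * x i - c * y i) \<partial>L)"
      unfolding G_density using m by (subst nn_integral_density) simp_all
    also have "\<dots> = (\<integral>\<^sup>+x. (?z * ?z) * (F (\<lambda>i. c * x i + s * y i) (\<lambda>i. s * x i - c * y i) * w x * w y) \<partial>L)"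
      using m by (subst nn_integral_cmult[symmetric]) (auto simp: mult_ac)
    also have "\<dots> = ?z * ?z * (\<integral>\<^sup>+x. F (\<lambda>i. c * x i + s * y i) (\<lambda>i. s * x i - c * y i) * w x * w y \<partial>L)"
      by (rule nn_integral_cmult) (use m in simp)
    finally show "(?z * w y) * (\<integral>\<^sup>+x. F (\<lambda>i. c * x i + s * y i) (\<lambda>i. s * x i - c * y i) \<partial>G) = \<dots>" .
  qed
  also have "\<dots> = ?z * ?z * (\<integral>\<^sup>+y. \<integral>\<^sup>+x. F (\<lambda>i. c * x i + s * y i) (\<lambda>i. s * x i - c * y i) * w x * w y \<partial>L \<partial>L)"
    by (rule nn_integral_cmult[OF m3])
  also have "\<dots> = ?z * ?z * (\<integral>\<^sup>+x. \<integral>\<^sup>+y. F x y * w x * w y \<partial>L \<partial>L)"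
    by (simp only: rotation_w[OF F cs(3,1)])
  also have "\<dots> \<le> ?z * ?z * (ennreal ((1 / ?\<tau>) ^ card I) * (\<phi> K (\<lambda>_. 0) * \<phi> K (\<lambda>_. 0)))"
    unfolding F_def by (intro mult_left_mono correlated_pair_le[OF K \<tau>]) simp
  also have "\<dots> = ennreal ((1 / ?\<tau>) ^ card I) * (emeasure G (K \<inter> space L) * emeasure G (K \<inter> space L))"
    unfolding emeasure_G_body[OF K] by (simp only: mult_ac)
  finally show ?thesis .
qed

section \<open>Independent copies of a Gaussian vector and their normalised signed sums\<close>

definition P :: "nat \<Rightarrow> (nat \<times> 'i \<Rightarrow> real) measure" where
  "P n = PiM ({..<n} \<times> I) (\<lambda>(k, i). normal_coord i)"

text \<open>Division by \<open>sqrt (card S)\<close> preserves the variances, so with coefficients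
  of modulus 1 the vector has law \<open>G\<close> for every nonempty \<open>S\<close>.\<close>

definition psum :: "(nat \<Rightarrow> real) \<Rightarrow> nat set \<Rightarrow> (nat \<times> 'i \<Rightarrow> real) \<Rightarrow> 'i \<Rightarrow> real" where
  "psum e S \<omega> i = (\<Sum>k\<in>S. e k * \<omega> (k, i)) / sqrt (card S)"

lemma prob_space_P: "prob_space (P n)"
  unfolding P_def by (intro prob_space_PiM) (auto intro!: prob_space_normal_density \<sigma>_pos)

lemma P_coord_measurable [measurable]:
  "k < n \<Longrightarrow> i \<in> I \<Longrightarrow> (\<lambda>\<omega>. \<omega> (k, i)) \<in> borel_measurable (P n)"
proof -
  assume "k < n" "i \<in> I"
  then have "(\<lambda>\<omega>. \<omega> (k, i)) \<in> measurable (P n) (case (k, i) of (k, i) \<Rightarrow> normal_coord i)"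
    unfolding P_def by (intro measurable_component_singleton) auto
  then show ?thesis by simp
qed

lemma indep_vars_P:
  assumes "I \<noteq> {}" "0 < n"
  shows "prob_space.indep_vars (P n) (\<lambda>_. borel) (\<lambda>p \<omega>. \<omega> p) ({..<n} \<times> I)"
proof -
  interpret prob_space "P n" by (rule prob_space_P)
  have ne: "{..<n} \<times> I \<noteq> {}" using assms by auto
  have comp: "distr (P n) borel (\<lambda>\<omega>. \<omega> p) = (case p of (k, i) \<Rightarrow> normal_coord i)" if "p \<in> {..<n} \<times> I" for p
  proof -
    have "distr (P n) borel (\<lambda>\<omega>. \<omega> p) = distr (P n) (case p of (k, i) \<Rightarrow> normal_coord i) (\<lambda>\<omega>. \<omega> p)"
      by (intro distr_cong) (auto split: prod.split)
    also have "\<dots> = (case p of (k, i) \<Rightarrow> normal_coord i)"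
      unfolding P_def using that
      by (intro distr_PiM_component) (auto intro!: prob_space_normal_density \<sigma>_pos)
    finally show ?thesis .
  qed
  have "distr (P n) (PiM ({..<n} \<times> I) (\<lambda>_. borel)) (\<lambda>\<omega>. \<lambda>p\<in>{..<n} \<times> I. \<omega> p) = distr (P n) (P n) (\<lambda>\<omega>. \<omega>)"
  proof (rule distr_cong)
    show "sets (PiM ({..<n} \<times> I) (\<lambda>_. borel)) = sets (P n)"
      unfolding P_def by (intro sets_PiM_cong) (auto split: prod.split)
    show "restrict \<omega> ({..<n} \<times> I) = \<omega>" if "\<omega> \<in> space (P n)" for \<omega>
      using that by (simp add: P_def space_PiM PiE_restrict)
  qed simp
  also have "\<dots> = PiM ({..<n} \<times> I) (\<lambda>p. distr (P n) borel (\<lambda>\<omega>. \<omega> p))"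
    unfolding distr_id2[OF refl] by (subst P_def) (rule PiM_cong, simp_all add: comp)
  finally show ?thesis
    by (intro indep_vars_iff_distr_eq_PiM'[THEN iffD2, OF ne]) auto
qed

lemma psum_measurable:
  assumes "S \<subseteq> {..<n}" "i \<in> I"
  shows "(\<lambda>\<omega>. psum e S \<omega> i) \<in> borel_measurable (P n)"
  unfolding psum_def using assms by (intro borel_measurable_divide borel_measurable_sum borel_measurable_times) auto

lemma distr_psum_coord:
  assumes S: "S \<subseteq> {..<n}" "S \<noteq> {}" and e: "\<And>k. k \<in> S \<Longrightarrow> \<bar>e k\<bar> = 1" and i: "i \<in> I"
  shows "distr (P n) borel (\<lambda>\<omega>. psum e S \<omega> i) = normal_coord i"
proof -
  interpret prob_space "P n" by (rule prob_space_P)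
  have fin: "finite S" using S(1) by (rule finite_subset) simp
  have n: "0 < n" using S by auto
  have c: "card S > 0" using fin S by (simp add: card_gt_0_iff)
  have "indep_vars (\<lambda>k. PiM {(k, i)} (\<lambda>_. borel)) (\<lambda>k \<omega>. restrict (\<lambda>p. \<omega> p) {(k, i)}) S"
    by (rule indep_vars_restrict[OF indep_vars_P]) (use i n S in \<open>auto simp: disjoint_family_on_def\<close>)
  then have "indep_vars (\<lambda>_. borel) (\<lambda>k \<omega>. restrict \<omega> {(k, i)} (k, i)) S"
    by (rule indep_vars_compose2[where Y="\<lambda>k \<omega>. \<omega> (k, i)"]) simp
  then have "indep_vars (\<lambda>_. borel) (\<lambda>k \<omega>. \<omega> (k, i)) S" by simp
  then have ind': "indep_vars (\<lambda>_. borel) (\<lambda>k \<omega>. e k * \<omega> (k, i)) S"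
    by (rule indep_vars_compose2[where Y="\<lambda>k x. e k * x"]) simp
  have coord: "distributed (P n) lborel (\<lambda>\<omega>. \<omega> (k, i)) (normal_density 0 (\<sigma> i))" if "k \<in> S" for k
  proof -
    have k: "(k, i) \<in> {..<n} \<times> I" using that S i by auto
    have "distr (P n) lborel (\<lambda>\<omega>. \<omega> (k, i)) = distr (P n) (case (k, i) of (k, i) \<Rightarrow> normal_coord i) (\<lambda>\<omega>. \<omega> (k, i))"
      by (intro distr_cong) auto
    also have "\<dots> = (case (k, i) of (k, i) \<Rightarrow> normal_coord i)"
      unfolding P_def using k
      by (intro distr_PiM_component) (auto intro!: prob_space_normal_density \<sigma>_pos)
    finally show ?thesis using k unfolding distributed_def by auto
  qed
  have "distributed (P n) lborel (\<lambda>\<omega>. \<Sum>k\<in>S. e k * \<omega> (k, i))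
      (normal_density (\<Sum>k\<in>S. 0) (sqrt (\<Sum>k\<in>S. (\<sigma> i)\<^sup>2)))"
  proof (rule sum_indep_normal[OF fin S(2) ind'])
    fix k assume k: "k \<in> S"
    have "e k \<noteq> 0" using e[OF k] by auto
    from normal_density_affine[OF coord[OF k] \<sigma>_pos[OF i] this, of 0] e[OF k]
    show "distributed (P n) lborel (\<lambda>\<omega>. e k * \<omega> (k, i)) (normal_density 0 (\<sigma> i))" by simp
  qed (use \<sigma>_pos[OF i] in auto)
  then have "distributed (P n) lborel (\<lambda>\<omega>. \<Sum>k\<in>S. e k * \<omega> (k, i)) (normal_density 0 (sqrt (card S) * \<sigma> i))"
    using \<sigma>_pos[OF i] by (simp add: real_sqrt_mult)
  from normal_density_affine[OF this, of "1 / sqrt (card S)" 0] c \<sigma>_pos[OF i]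
  have "distributed (P n) lborel (\<lambda>\<omega>. psum e S \<omega> i) (normal_density 0 (\<sigma> i))"
    by (simp add: psum_def)
  then have "distr (P n) lborel (\<lambda>\<omega>. psum e S \<omega> i) = normal_coord i"
    by (simp add: distributed_def)
  then show ?thesis by (simp cong: distr_cong)
qed

text \<open>Different coordinates i read disjoint blocks \<open>S \<times> {i}\<close> of the
  underlying variables, hence are independent, and the joint law is the product of the
  marginals.\<close>

lemma distr_psum:
  assumes S: "S \<subseteq> {..<n}" "S \<noteq> {}" and e: "\<And>k. k \<in> S \<Longrightarrow> \<bar>e k\<bar> = 1" and I: "I \<noteq> {}"
  shows "distr (P n) L (\<lambda>\<omega>. \<lambda>i\<in>I. psum e S \<omega> i) = G"
proof -
  interpret prob_space "P n" by (rule prob_space_P)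
  have n: "0 < n" using S by auto
  have fin: "finite S" using S(1) by (rule finite_subset) simp
  have "indep_vars (\<lambda>i. PiM (S \<times> {i}) (\<lambda>_. borel)) (\<lambda>i \<omega>. restrict (\<lambda>p. \<omega> p) (S \<times> {i})) I"
    by (rule indep_vars_restrict[OF indep_vars_P[OF I n]])
      (use S in \<open>auto simp: disjoint_family_on_def\<close>)
  then have "indep_vars (\<lambda>_. borel) (\<lambda>i \<omega>. psum e S (restrict \<omega> (S \<times> {i})) i) I"
    by (rule indep_vars_compose2[where Y="\<lambda>i \<omega>. psum e S \<omega> i"])
      (auto simp: psum_def fin intro!: borel_measurable_divide borel_measurable_sum borel_measurable_times)
  then have ind: "indep_vars (\<lambda>_. borel) (\<lambda>i \<omega>. psum e S \<omega> i) I"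
    by (simp add: psum_def cong: sum.cong)
  have "distr (P n) (PiM I (\<lambda>_. borel)) (\<lambda>\<omega>. \<lambda>i\<in>I. psum e S \<omega> i) = PiM I (\<lambda>i. distr (P n) borel (\<lambda>\<omega>. psum e S \<omega> i))"
    using indep_vars_iff_distr_eq_PiM'[THEN iffD1, OF I _ ind] psum_measurable[OF S(1)] by simp
  also have "\<dots> = G"
    unfolding G_def using distr_psum_coord[OF S e] by (intro PiM_cong) auto
  also have "distr (P n) (PiM I (\<lambda>_. borel)) (\<lambda>\<omega>. \<lambda>i\<in>I. psum e S \<omega> i) = distr (P n) L (\<lambda>\<omega>. \<lambda>i\<in>I. psum e S \<omega> i)"
    unfolding L_def by (intro distr_cong sets_PiM_cong) auto
  finally show ?thesis .
qed

lemma distr_psum_disjoint: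
  assumes S: "S \<subseteq> {..<n}" "S \<noteq> {}" and T: "T \<subseteq> {..<n}" "T \<noteq> {}" and ST: "S \<inter> T = {}"
    and e: "\<And>k. k \<in> S \<Longrightarrow> \<bar>e k\<bar> = 1" and f: "\<And>k. k \<in> T \<Longrightarrow> \<bar>f k\<bar> = 1" and I: "I \<noteq> {}"
  shows "distr (P n) (L \<Otimes>\<^sub>M L) (\<lambda>\<omega>. (\<lambda>i\<in>I. psum e S \<omega> i, \<lambda>i\<in>I. psum f T \<omega> i)) = G \<Otimes>\<^sub>M G"
proof -
  interpret prob_space "P n" by (rule prob_space_P)
  have n: "0 < n" using S by auto
  have fin: "finite S" "finite T" using S(1) T(1) by (auto intro: finite_subset[of _ "{..<n}"])
  have meas: "(\<lambda>\<omega>. \<lambda>i\<in>I. psum g A \<omega> i) \<in> measurable (PiM (A \<times> I) (\<lambda>_. borel)) L" if "finite A" for g A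
    by (intro measurable_to_L)
      (auto simp: psum_def that intro!: borel_measurable_divide borel_measurable_sum borel_measurable_times)
  have "indep_var (PiM (S \<times> I) (\<lambda>_. borel)) (\<lambda>\<omega>. restrict (\<lambda>p. \<omega> p) (S \<times> I))
      (PiM (T \<times> I) (\<lambda>_. borel)) (\<lambda>\<omega>. restrict (\<lambda>p. \<omega> p) (T \<times> I))"
    by (rule indep_var_restrict[OF indep_vars_P[OF I n]]) (use S T ST in auto)
  from indep_var_compose[OF this meas[OF fin(1), of e] meas[OF fin(2), of f]]
  have "indep_var L (\<lambda>\<omega>. \<lambda>i\<in>I. psum e S \<omega> i) L (\<lambda>\<omega>. \<lambda>i\<in>I. psum f T \<omega> i)"
    by (simp add: o_def psum_def cong: sum.cong restrict_cong)
  moreover have "distr (P n) L (\<lambda>\<omega>. \<lambda>i\<in>I. psum e S \<omega> i) = G" "distr (P n) L (\<lambda>\<omega>. \<lambda>i\<in>I. psum f T \<omega> i) = G"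
    by (rule distr_psum[OF S e I]; assumption) (rule distr_psum[OF T f I]; assumption)
  ultimately show ?thesis
    unfolding indep_var_distribution_eq by simp
qed

lemma psum_body_sets:
  assumes "body K" "S \<subseteq> {..<n}"
  shows "{\<omega> \<in> space (P n). psum e S \<omega> \<in> K} \<in> sets (P n)"
proof -
  have "(\<lambda>\<omega>. indicator K (\<lambda>i. psum e S \<omega> i) :: ennreal) \<in> borel_measurable (P n)"
    by (rule coord_measurable_comp[OF coord_measurable_body[OF assms(1)]]) (rule psum_measurable[OF assms(2)])
  then have "(indicator {\<omega>. psum e S \<omega> \<in> K} :: _ \<Rightarrow> ennreal) \<in> borel_measurable (P n)"
    by (simp add: indicator_def[abs_def])
  then have "{\<omega>. psum e S \<omega> \<in> K} \<inter> space (P n) \<in> sets (P n)"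
    by (simp add: borel_measurable_indicator_iff)
  then show ?thesis by (simp add: Int_def conj_commute)
qed

lemma emeasure_psum_body:
  assumes K: "body K" and S: "S \<subseteq> {..<n}" "S \<noteq> {}" and e: "\<And>k. k \<in> S \<Longrightarrow> \<bar>e k\<bar> = 1" and I: "I \<noteq> {}"
  shows "emeasure (P n) {\<omega> \<in> space (P n). psum e S \<omega> \<in> K} = emeasure G (K \<inter> space L)"
proof -
  have m: "(\<lambda>\<omega>. \<lambda>i\<in>I. psum e S \<omega> i) \<in> measurable (P n) L"
    by (intro measurable_to_L psum_measurable[OF S(1)])
  have "emeasure G (K \<inter> space L) = emeasure (distr (P n) L (\<lambda>\<omega>. \<lambda>i\<in>I. psum e S \<omega> i)) (K \<inter> space L)"
    by (simp add: distr_psum[OF S e I])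
  also have "\<dots> = emeasure (P n) ((\<lambda>\<omega>. \<lambda>i\<in>I. psum e S \<omega> i) -` (K \<inter> space L) \<inter> space (P n))"
    using K m by (subst emeasure_distr) (auto simp: body_def)
  also have "(\<lambda>\<omega>. \<lambda>i\<in>I. psum e S \<omega> i) -` (K \<inter> space L) \<inter> space (P n) = {\<omega> \<in> space (P n). psum e S \<omega> \<in> K}"
    using K m[THEN measurable_space] by (auto simp: body_def)
  finally show ?thesis by simp
qed

text \<open>Splitting the indices by agreement writes the two signed sums as c x + s y and c x - s
  y, where x and y are the normalised partial sums over \<open>S\<close> and \<open>T\<close>:
  independent, each with law \<open>G\<close>. Both sets are nonempty so that c and s are positive;
  the base of the power is 1 / (2 c s).\<close>

lemma emeasure_psum_pair:
  assumes K: "body K" and e: "\<And>k. k < n \<Longrightarrow> \<bar>e k\<bar> = 1" and f: "\<And>k. k < n \<Longrightarrow> f k = e k \<or> f k = - e k"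
    and S: "S = {k. k < n \<and> f k = e k}" "S \<noteq> {}" and T: "T = {k. k < n \<and> f k \<noteq> e k}" "T \<noteq> {}"
    and I: "I \<noteq> {}"
  shows "emeasure (P n) {\<omega> \<in> space (P n). psum e {..<n} \<omega> \<in> K \<and> psum f {..<n} \<omega> \<in> K}
     \<le> ennreal ((real n / (2 * sqrt (real (card S) * real (card T)))) ^ card I)
        * (emeasure G (K \<inter> space L) * emeasure G (K \<inter> space L))"
proof -
  define c where "c = sqrt (card S / n)"
  define s where "s = sqrt (card T / n)"
  have sub: "S \<subseteq> {..<n}" "T \<subseteq> {..<n}" "S \<inter> T = {}" "S \<union> T = {..<n}" using S T by auto
  have fin: "finite S" "finite T" using sub by (auto intro: finite_subset[of _ "{..<n}"])
  have cp: "card S > 0" "card T > 0" using S T fin by (auto simp: card_gt_0_iff)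
  have n: "card S + card T = n"
    using card_Un_disjoint[OF fin sub(3)] sub(4) by simp
  then have npos: "n > 0" using cp by simp
  have cs: "0 < c" "0 < s" "c\<^sup>2 + s\<^sup>2 = 1"
    unfolding c_def s_def using cp npos n
    by (simp_all add: add_divide_distrib[symmetric])
  have sum: "psum e {..<n} \<omega> = (\<lambda>i. c * psum e S \<omega> i + s * psum e T \<omega> i)"
       "psum f {..<n} \<omega> = (\<lambda>i. c * psum e S \<omega> i - s * psum e T \<omega> i)" for \<omega>
  proof -
    have c': "c * a / sqrt (card S) = a / sqrt n" and s': "s * a / sqrt (card T) = a / sqrt n" for a
      unfolding c_def s_def using cp npos by (simp_all add: real_sqrt_divide field_simps)
    have "(\<Sum>k<n. e k * \<omega> (k, i)) = (\<Sum>k\<in>S. e k * \<omega> (k, i)) + (\<Sum>k\<in>T. e k * \<omega> (k, i))" for i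
      using sum.union_disjoint[OF fin sub(3)] sub(4) by simp
    then show "psum e {..<n} \<omega> = (\<lambda>i. c * psum e S \<omega> i + s * psum e T \<omega> i)"
      by (simp add: fun_eq_iff psum_def c' s' add_divide_distrib)
    have "(\<Sum>k<n. f k * \<omega> (k, i)) = (\<Sum>k\<in>S. e k * \<omega> (k, i)) - (\<Sum>k\<in>T. e k * \<omega> (k, i))" for i
    proof -
      have "(\<Sum>k<n. f k * \<omega> (k, i)) = (\<Sum>k\<in>S. f k * \<omega> (k, i)) + (\<Sum>k\<in>T. f k * \<omega> (k, i))"
        using sum.union_disjoint[OF fin sub(3)] sub(4) by simp
      moreover have "(\<Sum>k\<in>S. f k * \<omega> (k, i)) = (\<Sum>k\<in>S. e k * \<omega> (k, i))"
        using S by (intro sum.cong) auto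
      moreover have "(\<Sum>k\<in>T. f k * \<omega> (k, i)) = - (\<Sum>k\<in>T. e k * \<omega> (k, i))"
      proof (unfold sum_negf[symmetric], rule sum.cong[OF refl])
        fix k assume "k \<in> T"
        then have "f k = - e k" using f[of k] T by auto
        then show "f k * \<omega> (k, i) = - (e k * \<omega> (k, i))" by simp
      qed
      ultimately show ?thesis by simp
    qed
    then show "psum f {..<n} \<omega> = (\<lambda>i. c * psum e S \<omega> i - s * psum e T \<omega> i)"
      by (simp add: fun_eq_iff psum_def c' s' diff_divide_distrib)
  qed
  have F: "coord_measurable2 (\<lambda>x y. indicator K (\<lambda>i. c * x i + s * y i) * indicator K (\<lambda>i. c * x i - s * y i))"
    by (intro coord_measurable2_mult
        coord_measurable2_compI[OF coord_measurable_body[OF K], of "\<lambda>i x y. c * x + s * y"]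
        coord_measurable2_compI[OF coord_measurable_body[OF K], of "\<lambda>i x y. c * x - s * y"]) simp_all
  then have Fm: "(\<lambda>(x, y). indicator K (\<lambda>i. c * x i + s * y i) * indicator K (\<lambda>i. c * x i - s * y i) :: ennreal)
      \<in> borel_measurable (L \<Otimes>\<^sub>M L)"
    by (simp add: coord_measurable2_def)
  have m: "(\<lambda>\<omega>. (\<lambda>i\<in>I. psum e S \<omega> i, \<lambda>i\<in>I. psum e T \<omega> i)) \<in> measurable (P n) (L \<Otimes>\<^sub>M L)"
    by (intro measurable_Pair measurable_to_L psum_measurable sub)
  have "{\<omega> \<in> space (P n). psum e {..<n} \<omega> \<in> K \<and> psum f {..<n} \<omega> \<in> K}
     = {\<omega> \<in> space (P n). psum e {..<n} \<omega> \<in> K} \<inter> {\<omega> \<in> space (P n). psum f {..<n} \<omega> \<in> K}" by auto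
  then have "{\<omega> \<in> space (P n). psum e {..<n} \<omega> \<in> K \<and> psum f {..<n} \<omega> \<in> K} \<in> sets (P n)"
    using psum_body_sets[OF K] by auto
  then have "emeasure (P n) {\<omega> \<in> space (P n). psum e {..<n} \<omega> \<in> K \<and> psum f {..<n} \<omega> \<in> K}
    = (\<integral>\<^sup>+\<omega>. indicator {\<omega> \<in> space (P n). psum e {..<n} \<omega> \<in> K \<and> psum f {..<n} \<omega> \<in> K} \<omega> \<partial>P n)"
    by simp
  also have "\<dots> = (\<integral>\<^sup>+\<omega>. (\<lambda>(x, y). indicator K (\<lambda>i. c * x i + s * y i) * indicator K (\<lambda>i. c * x i - s * y i))
      (\<lambda>i\<in>I. psum e S \<omega> i, \<lambda>i\<in>I. psum e T \<omega> i) \<partial>P n)"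
  proof (rule nn_integral_cong)
    fix \<omega> assume "\<omega> \<in> space (P n)"
    have "(\<lambda>i. c * restrict (psum e S \<omega>) I i + s * restrict (psum e T \<omega>) I i) \<in> K \<longleftrightarrow> psum e {..<n} \<omega> \<in> K"
      "(\<lambda>i. c * restrict (psum e S \<omega>) I i - s * restrict (psum e T \<omega>) I i) \<in> K \<longleftrightarrow> psum f {..<n} \<omega> \<in> K"
      unfolding sum by (rule body_cong[OF K]; simp)+
    then show "indicator {\<omega> \<in> space (P n). psum e {..<n} \<omega> \<in> K \<and> psum f {..<n} \<omega> \<in> K} \<omega>
      = ((\<lambda>(x, y). indicator K (\<lambda>i. c * x i + s * y i) * indicator K (\<lambda>i. c * x i - s * y i))
      (\<lambda>i\<in>I. psum e S \<omega> i, \<lambda>i\<in>I. psum e T \<omega> i) :: ennreal)"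
      using \<open>\<omega> \<in> space (P n)\<close> unfolding indicator_def by (simp del: restrict_apply)
  qed
  also have "\<dots> = (\<integral>\<^sup>+z. (\<lambda>(x, y). indicator K (\<lambda>i. c * x i + s * y i) * indicator K (\<lambda>i. c * x i - s * y i)) z \<partial>(G \<Otimes>\<^sub>M G))"
  proof -
    have D: "distr (P n) (L \<Otimes>\<^sub>M L) (\<lambda>\<omega>. (\<lambda>i\<in>I. psum e S \<omega> i, \<lambda>i\<in>I. psum e T \<omega> i)) = G \<Otimes>\<^sub>M G"
      by (rule distr_psum_disjoint[OF sub(1) S(2) sub(2) T(2) sub(3) _ _ I]) (use e sub in auto)
    show ?thesis unfolding D[symmetric] by (rule nn_integral_distr[OF m, symmetric]) (use Fm in simp)
  qed
  also have "\<dots> = (\<integral>\<^sup>+y. \<integral>\<^sup>+x. indicator K (\<lambda>i. c * x i + s * y i) * indicator K (\<lambda>i. c * x i - s * y i) \<partial>G \<partial>G)"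
    by (subst GG.nn_integral_snd[symmetric])
      (use Fm in \<open>simp_all cong: measurable_cong_sets sets_pair_measure_cong\<close>)
  also have "\<dots> \<le> ennreal ((1 / (2 * c * s)) ^ card I) * (emeasure G (K \<inter> space L) * emeasure G (K \<inter> space L))"
    by (rule rotated_pair_le[OF K cs])
  also have "1 / (2 * c * s) = real n / (2 * sqrt (real (card S) * real (card T)))"
    unfolding c_def s_def using npos by (simp add: real_sqrt_divide real_sqrt_mult)
  finally show ?thesis .
qed

end

section \<open>The spectral norm ball\<close>

definition upper :: "nat \<Rightarrow> (nat \<times> nat) set" where
  "upper m = {(i, j). i \<le> j \<and> j < m}"

definition goe_sd :: "nat \<times> nat \<Rightarrow> real" where
  "goe_sd = (\<lambda>(i, j). if i = j then sqrt 2 else 1)"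

definition sym_mat :: "(nat \<times> nat \<Rightarrow> real) \<Rightarrow> nat \<Rightarrow> nat \<Rightarrow> real" where
  "sym_mat x i j = x (min i j, max i j)"

text \<open>The norm ball as a family of constraints, one per vector, instead of a supremum:
  symmetry and midpoint convexity then follow vector by vector. The coordinates are the independent
  entries on and above the diagonal.\<close>

definition op_ball :: "nat \<Rightarrow> real \<Rightarrow> (nat \<times> nat \<Rightarrow> real) set" where
  "op_ball m s = {x. \<forall>v. L2_set (\<lambda>i. \<Sum>j<m. sym_mat x i j * v j) {..<m} \<le> s * L2_set v {..<m}}"

lemma upper_subset: "upper m \<subseteq> {..<m} \<times> {..<m}"
  by (auto simp: upper_def)

lemma finite_upper [simp, intro]: "finite (upper m)"
  by (rule finite_subset[OF upper_subset]) simp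

lemma upper_nonempty: "0 < m \<Longrightarrow> upper m \<noteq> {}"
  by (auto simp: upper_def)

lemma card_upper_le: "card (upper m) \<le> m\<^sup>2"
  using card_mono[OF _ upper_subset[of m]] by (simp add: power2_eq_square)

lemma card_upper_ge: "m\<^sup>2 \<le> 2 * card (upper m)"
proof -
  have "{..<m} \<times> {..<m} = upper m \<union> prod.swap ` upper m"
    by (auto simp: upper_def image_iff prod.swap_def)
  then have "m\<^sup>2 = card (upper m \<union> prod.swap ` upper m)"
    by (metis card_cartesian_product card_lessThan power2_eq_square)
  also have "\<dots> \<le> card (upper m) + card (prod.swap ` upper m)" by (rule card_Un_le)
  also have "\<dots> \<le> 2 * card (upper m)" using card_image_le[OF finite_upper, of prod.swap m] by simp
  finally show ?thesis .
qed

interpretation GW: gaussian_weight "upper m" goe_sd for m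
  by unfold_locales (auto simp: goe_sd_def)

lemma goe_index_eq: "goe_index n m = {..<n} \<times> upper m"
  by (auto simp: goe_index_def upper_def)

lemma goe_space_eq: "goe_space n m = GW.P m n"
  unfolding goe_space_def GW.P_def goe_index_eq
  by (intro PiM_cong) (auto simp: goe_sd_def)

text \<open>Homogeneity in v carries the bound from unit vectors to all vectors. A real
  \<open>Sup\<close> is informative only for a nonempty bounded set, so a unit vector is exhibited,
  using \<open>0 < m\<close>, and the Frobenius norm serves as upper bound.\<close>

lemma spec_norm_le_iff:
  assumes m: "0 < m"
  shows "spec_norm m A \<le> s \<longleftrightarrow>
    (\<forall>v. L2_set (\<lambda>i. \<Sum>j<m. A i j * v j) {..<m} \<le> s * L2_set v {..<m})"
proof -
  let ?A = "\<lambda>v. L2_set (\<lambda>i. \<Sum>j<m. A i j * v j) {..<m}"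
  define V where "V = {v. L2_set v {..<m} = 1}"
  have spec: "spec_norm m A = (SUP v\<in>V. ?A v)"
    by (simp add: spec_norm_def V_def L2_set_def setcompr_eq_image)
  have bound: "?A v \<le> L2_set (\<lambda>i. L2_set (\<lambda>j. A i j) {..<m}) {..<m}" if "L2_set v {..<m} = 1" for v
  proof -
    have "?A v \<le> L2_set (\<lambda>i. \<bar>\<Sum>j<m. A i j * v j\<bar>) {..<m}" by (simp add: L2_set_def)
    also have "\<dots> \<le> L2_set (\<lambda>i. L2_set (\<lambda>j. A i j) {..<m}) {..<m}"
    proof (rule L2_set_mono)
      fix i
      have "\<bar>\<Sum>j<m. A i j * v j\<bar> \<le> (\<Sum>j<m. \<bar>A i j\<bar> * \<bar>v j\<bar>)"
        by (rule order_trans[OF sum_abs]) (simp add: abs_mult)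
      also have "\<dots> \<le> L2_set (\<lambda>j. A i j) {..<m} * L2_set v {..<m}"
        by (rule L2_set_mult_ineq)
      finally show "\<bar>\<Sum>j<m. A i j * v j\<bar> \<le> L2_set (\<lambda>j. A i j) {..<m}" by (simp add: that)
    qed simp
    finally show ?thesis .
  qed
  have bdd: "bdd_above (?A ` V)"
    by (rule bdd_aboveI2[where M="L2_set (\<lambda>i. L2_set (\<lambda>j. A i j) {..<m}) {..<m}"])
      (rule bound, simp add: V_def)
  define v0 :: "nat \<Rightarrow> real" where "v0 = (\<lambda>j. if j = 0 then 1 else 0)"
  have "L2_set v0 {..<m} = 1"
    using m by (simp add: v0_def L2_set_def if_distrib[of "\<lambda>x. x\<^sup>2"] cong: if_cong)
  then have ne: "V \<noteq> {}" unfolding V_def by blast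
  have "(SUP v\<in>V. ?A v) \<le> s \<longleftrightarrow> (\<forall>v. ?A v \<le> s * L2_set v {..<m})"
  proof
    assume le: "(SUP v\<in>V. ?A v) \<le> s"
    show "\<forall>v. ?A v \<le> s * L2_set v {..<m}"
    proof
      fix v
      let ?r = "L2_set v {..<m}"
      show "?A v \<le> s * ?r"
      proof (cases "?r = 0")
        case True
        then have "v j = 0" if "j < m" for j using that by (simp add: L2_set_eq_0_iff)
        then have "?A v = 0" by (simp add: L2_set_def)
        then show ?thesis using True by simp
      next
        case False
        then have r: "?r > 0" using L2_set_nonneg[of v "{..<m}"] by linarith
        have "L2_set (\<lambda>j. (1 / ?r) * v j) {..<m} = (1 / ?r) * ?r"
          using r by (subst L2_set_right_distrib) auto
        then have "L2_set (\<lambda>j. (1 / ?r) * v j) {..<m} = 1" using r by simp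
        then have "(\<lambda>j. (1 / ?r) * v j) \<in> V" by (simp add: V_def)
        from order_trans[OF cSUP_upper[OF this bdd] le] have "?A (\<lambda>j. (1 / ?r) * v j) \<le> s" .
        moreover have "?A (\<lambda>j. (1 / ?r) * v j) = (1 / ?r) * ?A v"
        proof -
          have "(\<Sum>j<m. A i j * (1 / ?r * v j)) = (1 / ?r) * (\<Sum>j<m. A i j * v j)" for i
            by (simp add: sum_distrib_left mult_ac)
          then show ?thesis using r by (simp only:) (subst L2_set_right_distrib, auto)
        qed
        ultimately have "?A v / ?r \<le> s" by simp
        then show ?thesis using r by (simp only: pos_divide_le_eq)
      qed
    qed
  next
    assume "\<forall>v. ?A v \<le> s * L2_set v {..<m}"
    then have "?A v \<le> s" if "v \<in> V" for v
    proof -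
      have "L2_set v {..<m} = 1" using that by (simp add: V_def)
      moreover have "?A v \<le> s * L2_set v {..<m}" using \<open>\<forall>v. ?A v \<le> s * L2_set v {..<m}\<close> ..
      ultimately show ?thesis by simp
    qed
    then show "(SUP v\<in>V. ?A v) \<le> s" by (rule cSUP_least[OF ne])
  qed
  then show ?thesis unfolding spec .
qed

lemma sym_mat_restrict: "i < m \<Longrightarrow> j < m \<Longrightarrow> sym_mat (restrict x (upper m)) i j = sym_mat x i j"
  by (auto simp: sym_mat_def upper_def)

text \<open>Both sides are continuous in v, so rational vectors suffice. The extensional ones form a
  countable set, which presents the ball as a countable intersection and makes it
  measurable.\<close>

lemma op_ball_rational:
  assumes "\<And>v. v \<in> PiE {..<m} (\<lambda>_. \<rat>) \<Longrightarrow>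
    L2_set (\<lambda>i. \<Sum>j<m. sym_mat x i j * v j) {..<m} \<le> s * L2_set v {..<m}"
  shows "x \<in> op_ball m s"
  unfolding op_ball_def
proof (intro CollectI allI)
  fix v :: "nat \<Rightarrow> real"
  have "\<exists>f. (\<forall>k. f k \<in> \<rat>) \<and> f \<longlonglongrightarrow> v j" for j
    using closure_sequential[of "v j" "\<rat>"] by (simp add: Rats_closure_real)
  then obtain f where f: "\<And>j k. f j k \<in> \<rat>" "\<And>j. f j \<longlonglongrightarrow> v j" by metis
  have "L2_set (\<lambda>i. \<Sum>j<m. sym_mat x i j * f j k) {..<m} \<le> s * L2_set (\<lambda>j. f j k) {..<m}" for k
  proof -
    have "L2_set (\<lambda>i. \<Sum>j<m. sym_mat x i j * restrict (\<lambda>j. f j k) {..<m} j) {..<m}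
        \<le> s * L2_set (restrict (\<lambda>j. f j k) {..<m}) {..<m}"
      by (rule assms, rule PiE_I) (use f in auto)
    then show ?thesis by (simp add: L2_set_def)
  qed
  moreover have "(\<lambda>k. L2_set (\<lambda>i. \<Sum>j<m. sym_mat x i j * f j k) {..<m})
      \<longlonglongrightarrow> L2_set (\<lambda>i. \<Sum>j<m. sym_mat x i j * v j) {..<m}"
    unfolding L2_set_def by (intro tendsto_intros f)
  moreover have "(\<lambda>k. s * L2_set (\<lambda>j. f j k) {..<m}) \<longlonglongrightarrow> s * L2_set v {..<m}"
    unfolding L2_set_def by (intro tendsto_intros f)
  ultimately show "L2_set (\<lambda>i. \<Sum>j<m. sym_mat x i j * v j) {..<m} \<le> s * L2_set v {..<m}"
    by (intro LIMSEQ_le) auto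
qed

lemma body_op_ball: "GW.body m (op_ball m s)"
  unfolding GW.body_def
proof (intro conjI allI ballI)
  have "restrict (\<lambda>_. 0) {..<m} \<in> PiE {..<m} (\<lambda>_. \<rat> :: real set)" by auto
  then have ne: "PiE {..<m} (\<lambda>_. \<rat>) \<noteq> ({} :: (nat \<Rightarrow> real) set)" by blast
  have eq: "op_ball m s \<inter> space (GW.L m) = (\<Inter>v \<in> PiE {..<m} (\<lambda>_. \<rat>).
    {x \<in> space (GW.L m). L2_set (\<lambda>i. \<Sum>j<m. sym_mat x i j * v j) {..<m} \<le> s * L2_set v {..<m}})"
  proof (rule equalityI)
    show "(\<Inter>v \<in> PiE {..<m} (\<lambda>_. \<rat>).
      {x \<in> space (GW.L m). L2_set (\<lambda>i. \<Sum>j<m. sym_mat x i j * v j) {..<m} \<le> s * L2_set v {..<m}})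
      \<subseteq> op_ball m s \<inter> space (GW.L m)"
      using op_ball_rational[of m _ s] ne by blast
  qed (auto simp: op_ball_def)
  have meas: "(\<lambda>x. sym_mat x i j) \<in> borel_measurable (GW.L m)" if "i < m" "j < m" for i j
    unfolding sym_mat_def by (rule GW.measurable_coord_L) (use that in \<open>auto simp: upper_def\<close>)
  have cnt: "countable (PiE {..<m} (\<lambda>_. \<rat>) :: (nat \<Rightarrow> real) set)"
    by (intro countable_PiE) (auto simp: countable_rat)
  show "op_ball m s \<inter> space (GW.L m) \<in> sets (GW.L m)"
    unfolding eq
  proof (rule sets.countable_INT'[OF cnt ne])
    have [measurable]: "(\<lambda>x. L2_set (\<lambda>i. \<Sum>j<m. sym_mat x i j * v j) {..<m}) \<in> borel_measurable (GW.L m)" for v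
      unfolding L2_set_def
      by (intro measurable_compose[OF _ borel_measurable_sqrt] borel_measurable_sum borel_measurable_power borel_measurable_times
          borel_measurable_const meas) auto
    have "{x \<in> space (GW.L m). L2_set (\<lambda>i. \<Sum>j<m. sym_mat x i j * v j) {..<m} \<le> s * L2_set v {..<m}} \<in> sets (GW.L m)" for v
      by measurable
    then show "(\<lambda>v. {x \<in> space (GW.L m). L2_set (\<lambda>i. \<Sum>j<m. sym_mat x i j * v j) {..<m} \<le> s * L2_set v {..<m}})
      ` PiE {..<m} (\<lambda>_. \<rat>) \<subseteq> sets (GW.L m)" by blast
  qed
next
  fix x :: "nat \<times> nat \<Rightarrow> real"
  have "(\<Sum>j<m. sym_mat (restrict x (upper m)) i j * v j) = (\<Sum>j<m. sym_mat x i j * v j)" if "i < m" for i v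
    using that by (intro sum.cong) (auto simp: sym_mat_restrict)
  then have "L2_set (\<lambda>i. \<Sum>j<m. sym_mat (restrict x (upper m)) i j * v j) {..<m}
      = L2_set (\<lambda>i. \<Sum>j<m. sym_mat x i j * v j) {..<m}" for v
    by (intro L2_set_cong) auto
  then show "restrict x (upper m) \<in> op_ball m s \<longleftrightarrow> x \<in> op_ball m s"
    by (simp add: op_ball_def)
next
  fix x assume "x \<in> op_ball m s"
  then show "(\<lambda>i. - x i) \<in> op_ball m s"
    by (simp add: op_ball_def sym_mat_def L2_set_def sum_negf)
next
  fix x y assume xy: "x \<in> op_ball m s" "y \<in> op_ball m s"
  show "(\<lambda>i. (x i + y i) / 2) \<in> op_ball m s"
    unfolding op_ball_def
  proof (intro CollectI allI)
    fix v :: "nat \<Rightarrow> real"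
    have "(\<Sum>j<m. sym_mat (\<lambda>i. (x i + y i) / 2) i j * v j)
      = 1 / 2 * ((\<Sum>j<m. sym_mat x i j * v j) + (\<Sum>j<m. sym_mat y i j * v j))" for i
    proof -
      have "1 / 2 * ((\<Sum>j<m. sym_mat x i j * v j) + (\<Sum>j<m. sym_mat y i j * v j))
        = (\<Sum>j<m. 1 / 2 * (sym_mat x i j * v j + sym_mat y i j * v j))"
        by (subst sum.distrib[symmetric]) (rule sum_distrib_left)
      also have "\<dots> = (\<Sum>j<m. sym_mat (\<lambda>i. (x i + y i) / 2) i j * v j)"
        by (intro sum.cong refl) (simp add: sym_mat_def field_simps)
      finally show ?thesis by simp
    qed
    then have "L2_set (\<lambda>i. \<Sum>j<m. sym_mat (\<lambda>i. (x i + y i) / 2) i j * v j) {..<m}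
      = 1 / 2 * L2_set (\<lambda>i. (\<Sum>j<m. sym_mat x i j * v j) + (\<Sum>j<m. sym_mat y i j * v j)) {..<m}"
      by (simp only:) (subst L2_set_right_distrib, auto)
    also have "\<dots> \<le> 1 / 2 * (L2_set (\<lambda>i. \<Sum>j<m. sym_mat x i j * v j) {..<m} + L2_set (\<lambda>i. \<Sum>j<m. sym_mat y i j * v j) {..<m})"
      by (intro mult_left_mono L2_set_triangle_ineq) simp
    also have "\<dots> \<le> 1 / 2 * (s * L2_set v {..<m} + s * L2_set v {..<m})"
      using xy by (intro mult_left_mono add_mono) (auto simp: op_ball_def)
    finally show "L2_set (\<lambda>i. \<Sum>j<m. sym_mat (\<lambda>i. (x i + y i) / 2) i j * v j) {..<m} \<le> s * L2_set v {..<m}"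
      by simp
  qed
qed

lemma op_ball_scale:
  assumes "0 < t"
  shows "(\<lambda>p. t * x p) \<in> op_ball m s \<longleftrightarrow> x \<in> op_ball m (s / t)"
proof -
  have "L2_set (\<lambda>i. \<Sum>j<m. sym_mat (\<lambda>p. t * x p) i j * v j) {..<m} = t * L2_set (\<lambda>i. \<Sum>j<m. sym_mat x i j * v j) {..<m}" for v
    using assms by (subst L2_set_right_distrib) (auto simp: sym_mat_def sum_distrib_left mult_ac)
  then show ?thesis using assms by (simp add: op_ball_def field_simps)
qed

text \<open>Testing on basis vectors bounds each of the m columns by s in Euclidean norm, and all
  standard deviations are at least 1. For s = o(sqrt m) the result is o(m^2), small against the
  dimension, so dilation gains nearly its full volume factor.\<close>

lemma q_op_ball:
  assumes x: "x \<in> op_ball m s" and s: "0 \<le> s"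
  shows "GW.q m x \<le> real m * s\<^sup>2 / 2"
proof -
  have col: "(\<Sum>i<m. (sym_mat x i j)\<^sup>2) \<le> s\<^sup>2" if j: "j < m" for j
  proof -
    define v :: "nat \<Rightarrow> real" where "v = (\<lambda>k. if k = j then 1 else 0)"
    have "L2_set v {..<m} = 1"
      using j by (simp add: v_def L2_set_def if_distrib[of "\<lambda>x. x\<^sup>2"] cong: if_cong)
    moreover have "(\<Sum>k<m. sym_mat x i k * v k) = sym_mat x i j" for i
      using j by (simp add: v_def if_distrib cong: if_cong)
    ultimately have "L2_set (\<lambda>i. sym_mat x i j) {..<m} \<le> s"
      using x by (auto simp: op_ball_def dest!: spec[of _ v])
    then have "(L2_set (\<lambda>i. sym_mat x i j) {..<m})\<^sup>2 \<le> s\<^sup>2"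
      by (intro power_mono) auto
    then show ?thesis by (simp add: L2_set_def sum_nonneg)
  qed
  have "GW.q m x \<le> (\<Sum>p\<in>upper m. (x p)\<^sup>2 / 2)"
    unfolding GW.q_def by (intro sum_mono) (auto simp: goe_sd_def split: prod.split intro!: divide_left_mono)
  also have "\<dots> = (\<Sum>(i, j)\<in>upper m. (sym_mat x i j)\<^sup>2 / 2)"
    by (intro sum.cong) (auto simp: upper_def sym_mat_def min_def max_def)
  also have "\<dots> \<le> (\<Sum>(i, j)\<in>{..<m} \<times> {..<m}. (sym_mat x i j)\<^sup>2 / 2)"
    by (intro sum_mono2 upper_subset) auto
  also have "\<dots> = (\<Sum>j<m. (\<Sum>i<m. (sym_mat x i j)\<^sup>2) / 2)"
    by (subst sum.cartesian_product[symmetric], subst sum.swap) (simp add: sum_divide_distrib)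
  also have "\<dots> \<le> (\<Sum>j<m. s\<^sup>2 / 2)"
    using col by (intro sum_mono) auto
  finally show ?thesis by simp
qed

section \<open>Signings, and discrepancy in terms of the norm ball\<close>

definition signs :: "nat \<Rightarrow> (nat \<Rightarrow> real) set" where
  "signs n = PiE {..<n} (\<lambda>_. {-1, 1})"

lemma finite_signs [simp, intro]: "finite (signs n)"
  unfolding signs_def by (intro finite_PiE) auto

lemma card_signs: "card (signs n) = 2 ^ n"
  unfolding signs_def by (simp add: card_PiE numeral_2_eq_2)

lemma signs_abs: "e \<in> signs n \<Longrightarrow> k < n \<Longrightarrow> \<bar>e k\<bar> = 1"
  by (auto simp: signs_def PiE_def Pi_def)

text \<open>The radius is measured in units of sqrt n because \<open>psum\<close> is normalised; the
  same ball then serves for a sum of n matrices and for a single one.\<close>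

lemma spec_norm_signed_sum_le_iff:
  assumes "0 < m" "0 < n"
  shows "spec_norm m (\<lambda>i j. \<Sum>k<n. e k * goe_mat \<omega> k i j) \<le> sqrt n * s
    \<longleftrightarrow> GW.psum e {..<n} \<omega> \<in> op_ball m s"
proof -
  have "(\<lambda>i j. \<Sum>k<n. e k * goe_mat \<omega> k i j) = sym_mat (\<lambda>p. sqrt n * GW.psum e {..<n} \<omega> p)"
    using assms by (simp add: fun_eq_iff sym_mat_def goe_mat_def GW.psum_def)
  then have "spec_norm m (\<lambda>i j. \<Sum>k<n. e k * goe_mat \<omega> k i j) \<le> sqrt n * s
    \<longleftrightarrow> (\<lambda>p. sqrt n * GW.psum e {..<n} \<omega> p) \<in> op_ball m (sqrt n * s)"
    using spec_norm_le_iff[OF assms(1)] by (simp add: op_ball_def)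
  also have "\<dots> \<longleftrightarrow> GW.psum e {..<n} \<omega> \<in> op_ball m s"
    using op_ball_scale[of "sqrt n" _ m "sqrt n * s"] assms by simp
  finally show ?thesis .
qed

lemma disc_le_iff:
  assumes "0 < m" "0 < n"
  shows "disc n m (goe_mat \<omega>) \<le> sqrt n * s \<longleftrightarrow> (\<exists>e\<in>signs n. GW.psum e {..<n} \<omega> \<in> op_ball m s)"
proof -
  have "signs n \<noteq> {}" by (auto simp: signs_def PiE_eq_empty_iff)
  then show ?thesis
    unfolding disc_def signs_def[symmetric] spec_norm_signed_sum_le_iff[OF assms, symmetric]
    by (subst Min_le_iff) auto
qed

lemma spec_norm_nonneg:
  assumes "0 < m" shows "0 \<le> spec_norm m A"
proof -
  define v :: "nat \<Rightarrow> real" where "v = (\<lambda>j. if j = 0 then 1 else 0)"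
  have "L2_set v {..<m} = 1"
    using assms by (simp add: v_def L2_set_def if_distrib[of "\<lambda>x. x\<^sup>2"] cong: if_cong)
  then have "L2_set (\<lambda>i. \<Sum>j<m. A i j * v j) {..<m} \<le> spec_norm m A"
    using spec_norm_le_iff[OF assms, of A "spec_norm m A"] by (auto dest!: spec[of _ v])
  then show ?thesis by (rule order_trans[OF L2_set_nonneg])
qed

lemma disc_nonneg:
  assumes "0 < m" shows "0 \<le> disc n m A"
proof -
  have "signs n \<noteq> {}" by (auto simp: signs_def PiE_eq_empty_iff)
  then show ?thesis
    unfolding disc_def signs_def[symmetric] using spec_norm_nonneg[OF assms]
    by (subst Min_ge_iff) auto
qed

section \<open>Binomial sums and the second moment\<close>

text \<open>This is Hoeffding's lemma for a fair sign: with parameters 2 x and 1 / 2 it bounds ln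
  ((1 + exp (2 x)) / 2) = x + ln (cosh x) for nonnegative x, and evenness gives the rest.\<close>

lemma cosh_le_exp_square: "(exp x + exp (- x)) / 2 \<le> exp (x\<^sup>2 / 2)" for x :: real
proof -
  have pos: "(exp x + exp (- x)) / 2 \<le> exp (x\<^sup>2 / 2)" if "0 \<le> x" for x :: real
  proof -
    have "- (2 * x) * (1 / 2) + ln (1 + 1 / 2 * (exp (2 * x) - 1)) \<le> (2 * x)\<^sup>2 / 8"
      using Hoeffdings_lemma_aux[of "2 * x" "1 / 2"] that by simp
    then have "ln (1 + 1 / 2 * (exp (2 * x) - 1)) \<le> x\<^sup>2 / 2 + x" by (simp add: power_mult_distrib)
    moreover have pos: "0 < 1 + 1 / 2 * (exp (2 * x) - 1)"
    proof -
      have "1 + 1 / 2 * (exp (2 * x) - 1) = (1 + exp (2 * x)) / 2" by (simp add: field_simps)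
      also have "\<dots> > 0" by (intro divide_pos_pos add_pos_pos) simp_all
      finally show ?thesis .
    qed
    ultimately have "1 + 1 / 2 * (exp (2 * x) - 1) \<le> exp (x\<^sup>2 / 2 + x)"
      by (metis exp_le_cancel_iff exp_ln)
    then have "(1 + 1 / 2 * (exp (2 * x) - 1)) * exp (- x) \<le> exp (x\<^sup>2 / 2 + x) * exp (- x)"
      by (rule mult_right_mono) simp
    moreover have "(1 + 1 / 2 * (exp (2 * x) - 1)) * exp (- x) = (exp x + exp (- x)) / 2"
      by (simp add: field_simps flip: exp_add)
    ultimately show ?thesis by (simp flip: exp_add)
  qed
  show ?thesis using pos[of x] pos[of "- x"] by (cases "0 \<le> x") (auto simp: add.commute)
qed

text \<open>Pascal's rule, read as adding one more sign: the number of disagreements stays at b or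
  becomes b + 1.\<close>

lemma sum_choose_Suc:
  fixes h :: "nat \<Rightarrow> real"
  shows "(\<Sum>b\<le>Suc n. real (Suc n choose b) * h b) = (\<Sum>b\<le>n. real (n choose b) * (h b + h (Suc b)))"
proof -
  have "(\<Sum>b\<le>Suc n. real (Suc n choose b) * h b)
      = h 0 + (\<Sum>b\<le>n. real (n choose b) * h (Suc b)) + (\<Sum>b\<le>n. real (n choose Suc b) * h (Suc b))"
    by (subst sum.atMost_Suc_shift) (simp add: sum.distrib algebra_simps)
  moreover have "(\<Sum>b\<le>Suc n. real (n choose b) * h b) = h 0 + (\<Sum>b\<le>n. real (n choose Suc b) * h (Suc b))"
    by (subst sum.atMost_Suc_shift) simp
  moreover have "(\<Sum>b\<le>Suc n. real (n choose b) * h b) = (\<Sum>b\<le>n. real (n choose b) * h b)"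
    by simp
  ultimately show ?thesis by (simp add: sum.distrib distrib_left)
qed

text \<open>Averaging over the last sign replaces \<open>1 / A\<close> by \<open>1 / A + 2 / A\<^sup>2 \<le> 1 / (A - 2)\<close>,
  which is what makes the induction close.\<close>

lemma sum_choose_exp_square_le:
  assumes "2 * real n < A"
  shows "(\<Sum>b\<le>n. real (n choose b) * exp ((real n - 2 * real b)\<^sup>2 / A)) \<le> 2 ^ n * exp (real n / (A - 2 * real n))"
  using assms
proof (induction n arbitrary: A)
  case (Suc n)
  have A: "A > 2" "2 * real n < A - 2" using Suc.prems by auto
  have step: "exp ((real (Suc n) - 2 * real b)\<^sup>2 / A) + exp ((real (Suc n) - 2 * real (Suc b))\<^sup>2 / A)
     \<le> 2 * exp (1 / A) * exp ((real n - 2 * real b)\<^sup>2 / (A - 2))" for b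
  proof -
    define S where "S = real n - 2 * real b"
    have "exp ((real (Suc n) - 2 * real b)\<^sup>2 / A) + exp ((real (Suc n) - 2 * real (Suc b))\<^sup>2 / A)
      = exp ((S + 1)\<^sup>2 / A) + exp ((S - 1)\<^sup>2 / A)" by (simp add: S_def algebra_simps)
    also have "(S + 1)\<^sup>2 / A = (S\<^sup>2 + 1) / A + 2 * S / A" by (simp add: power2_eq_square add_divide_distrib algebra_simps)
    also have "(S - 1)\<^sup>2 / A = (S\<^sup>2 + 1) / A + - (2 * S / A)" by (simp add: power2_eq_square add_divide_distrib diff_divide_distrib algebra_simps)
    also have "exp ((S\<^sup>2 + 1) / A + 2 * S / A) + exp ((S\<^sup>2 + 1) / A + - (2 * S / A))
      = 2 * exp ((S\<^sup>2 + 1) / A) * ((exp (2 * S / A) + exp (- (2 * S / A))) / 2)"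
      by (simp only: exp_add) (simp add: distrib_left)
    also have "\<dots> \<le> 2 * exp ((S\<^sup>2 + 1) / A) * exp ((2 * S / A)\<^sup>2 / 2)"
      by (intro mult_left_mono cosh_le_exp_square) simp
    also have "\<dots> = 2 * (exp (1 / A) * exp (S\<^sup>2 * (1 / A + 2 / A\<^sup>2)))"
      by (simp add: power2_eq_square add_divide_distrib algebra_simps flip: exp_add)
    also have "\<dots> \<le> 2 * (exp (1 / A) * exp (S\<^sup>2 * (1 / (A - 2))))"
    proof -
      have "1 / A + 2 / A\<^sup>2 \<le> 1 / (A - 2)"
        using A by (simp add: power2_eq_square divide_simps) (simp add: algebra_simps)
      then show ?thesis by (intro mult_left_mono iffD2[OF exp_le_cancel_iff]) auto
    qed
    finally show ?thesis by (simp add: S_def)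
  qed
  have "(\<Sum>b\<le>Suc n. real (Suc n choose b) * exp ((real (Suc n) - 2 * real b)\<^sup>2 / A))
    = (\<Sum>b\<le>n. real (n choose b) * (exp ((real (Suc n) - 2 * real b)\<^sup>2 / A) + exp ((real (Suc n) - 2 * real (Suc b))\<^sup>2 / A)))"
    by (rule sum_choose_Suc)
  also have "\<dots> \<le> (\<Sum>b\<le>n. real (n choose b) * (2 * exp (1 / A) * exp ((real n - 2 * real b)\<^sup>2 / (A - 2))))"
    by (intro sum_mono mult_left_mono step) simp
  also have "\<dots> = 2 * exp (1 / A) * (\<Sum>b\<le>n. real (n choose b) * exp ((real n - 2 * real b)\<^sup>2 / (A - 2)))"
    by (simp add: sum_distrib_left mult_ac)
  also have "\<dots> \<le> 2 * exp (1 / A) * (2 ^ n * exp (real n / (A - 2 - 2 * real n)))"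
    by (intro mult_left_mono Suc.IH A) simp
  also have "\<dots> = 2 ^ Suc n * exp (1 / A + real n / (A - 2 - 2 * real n))"
    by (simp add: exp_add)
  also have "\<dots> \<le> 2 ^ Suc n * exp (real (Suc n) / (A - 2 * real (Suc n)))"
  proof -
    have "1 / A \<le> 1 / (A - 2 * real (Suc n))" using Suc.prems by (intro divide_left_mono) auto
    moreover have "A - 2 - 2 * real n = A - 2 * real (Suc n)" by simp
    ultimately have "1 / A + real n / (A - 2 - 2 * real n) \<le> real (Suc n) / (A - 2 * real (Suc n))"
      by (simp only: of_nat_Suc add_divide_distrib)
    then show ?thesis by simp
  qed
  finally show ?case .
qed simp

lemma sum_choose_exp:
  "(\<Sum>b\<le>n. real (n choose b) * exp (- (l * real b))) = (1 + exp (- l)) ^ n"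
  "(\<Sum>b\<le>n. real (n choose b) * exp (- (l * real (n - b)))) = (1 + exp (- l)) ^ n"
proof -
  have e: "exp (- (l * real b)) = exp (- l) ^ b" for b
    by (simp add: exp_of_nat_mult[symmetric] mult.commute)
  show "(\<Sum>b\<le>n. real (n choose b) * exp (- (l * real b))) = (1 + exp (- l)) ^ n"
    unfolding e by (subst add.commute, subst binomial_ring) simp
  show "(\<Sum>b\<le>n. real (n choose b) * exp (- (l * real (n - b)))) = (1 + exp (- l)) ^ n"
    unfolding e by (subst binomial_ring) simp
qed

text \<open>Three ranges of the Hamming distance \<open>b\<close>: within \<open>\<eta> n\<close> of \<open>0\<close> or \<open>n\<close> only the trivial bound
  \<open>1 / p\<close> is used; down to a constant fraction the overlap factor is at most \<open>exp (n / 32)\<close>, which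
  the binomial tail beats; in the bulk the overlap factor is Gaussian in \<open>n - 2 b\<close>.\<close>

lemma sum_choose_overlap_le:
  fixes H :: "nat \<Rightarrow> real"
  assumes d: "0 < d" and n: "2 * d < n" and p: "0 < p"
    and H1: "\<And>b. b \<le> n \<Longrightarrow> H b \<le> 1 / p"
    and H2: "\<And>b. 0 < b \<Longrightarrow> b < n \<Longrightarrow> H b \<le> (real n / (2 * sqrt (real b * real (n - b)))) ^ d"
  defines "l \<equiv> real n / (16 * real d)"
  shows "(\<Sum>b\<le>n. real (n choose b) * H b) / 2 ^ n
    \<le> 2 * exp (exp (- l) * real n * (1 + l)) / (2 ^ n * p) + exp (1 / 2 - real n / 32) + exp (real d / (real n - 2 * real d))"
proof -
  \<comment> \<open>Chosen so that within this fraction of an end only exp (o d) signings are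
    counted as l grows, while beyond it the overlap factor is at most exp (l d / 2) = exp (n /
    32).\<close>
  define \<eta> where "\<eta> = exp (- l)"
  have n0: "0 < real n" using n by simp
  have l0: "0 < l" using d n0 by (simp add: l_def)
  \<comment> \<open>Indicators of the ranges are replaced by exponential majorants, so that all sums
    run over every b. \<open>T1\<close> uses exp (l (\<eta> n - b)) and its mirror image;
    \<open>T2\<close> uses exp ((n - 2 b)^2 / (4 n) - n / 16), which is at least 1 once |n - 2 b| is
    at least n / 2.\<close>
  define T1 where "T1 b = (exp (- (l * real b)) + exp (- (l * real (n - b)))) * (exp (l * \<eta> * real n) / p)" for b
  define T2 where "T2 b = exp ((real n - 2 * real b)\<^sup>2 / (4 * real n)) * exp (real n / 32 - real n / 16)" for b
  define T3 where "T3 b = exp ((real n - 2 * real b)\<^sup>2 / ((real n)\<^sup>2 / real d))" for b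
  have T_nonneg: "0 \<le> T1 b" "0 \<le> T2 b" "0 \<le> T3 b" for b using p by (auto simp: T1_def T2_def T3_def)
  have point: "H b \<le> T1 b + T2 b + T3 b" if b: "b \<le> n" for b
  proof (cases "real b \<le> \<eta> * real n \<or> real (n - b) \<le> \<eta> * real n")
    case True
    have "1 \<le> (exp (- (l * real b)) + exp (- (l * real (n - b)))) * exp (l * \<eta> * real n)"
    proof -
      from True have "1 \<le> exp (l * \<eta> * real n - l * real b) \<or> 1 \<le> exp (l * \<eta> * real n - l * real (n - b))"
        using l0 by (simp add: mult.assoc)
      moreover have "0 \<le> exp (l * \<eta> * real n - l * real b)" "0 \<le> exp (l * \<eta> * real n - l * real (n - b))" by simp_all
      ultimately have "1 \<le> exp (l * \<eta> * real n - l * real b) + exp (l * \<eta> * real n - l * real (n - b))" by linarith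
      also have "\<dots> = (exp (- (l * real b)) + exp (- (l * real (n - b)))) * exp (l * \<eta> * real n)"
        by (simp add: distrib_right flip: exp_add)
      finally show ?thesis .
    qed
    then have "1 / p \<le> T1 b" using p by (simp add: T1_def field_simps)
    then show ?thesis using H1[OF b] T_nonneg[of b] by linarith
  next
    case False
    then have big: "\<eta> * real n < real b" "\<eta> * real n < real (n - b)" by auto
    have "0 < \<eta> * real n" using n0 by (simp add: \<eta>_def)
    then have b': "0 < b" "b < n" using big by (auto intro: gr0I)
    define Q where "Q = real b * real (n - b)"
    have Q0: "0 < Q" using b' by (simp add: Q_def)
    have nb: "real (n - b) = real n - real b" using b by simp
    have Hb: "H b \<le> (real n / (2 * sqrt Q)) ^ d" using H2[OF b'] by (simp add: Q_def)
    have base: "real n / (2 * sqrt Q) = sqrt ((real n)\<^sup>2 / (4 * Q))"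
      by (simp add: real_sqrt_divide real_sqrt_mult)
    show ?thesis
    proof (cases "\<bar>real n - 2 * real b\<bar> \<le> real n / 2")
      case True
      \<comment> \<open>This is the squared correlation of the two signings, and n^2 / (4 Q) equals
        1 / (1 - x). For x at most 1 / 2 that is at most exp (2 x); the square root and the power d
        leave exp (d x), which is \<open>T3\<close>.\<close>
      define x where "x = ((real n - 2 * real b) / real n)\<^sup>2"
      have x0: "0 \<le> x" by (simp add: x_def)
      have "\<bar>(real n - 2 * real b) / real n\<bar> \<le> 1 / 2" using True n0 by (simp add: field_simps)
      then have "x \<le> (1 / 2)\<^sup>2" unfolding x_def using abs_le_square_iff[of "(real n - 2 * real b) / real n" "1 / 2"] by simp
      then have x: "x \<le> 1 / 2" by (simp add: power2_eq_square)
      have Qx: "4 * Q = (real n)\<^sup>2 * (1 - x)"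
      proof -
        have "(real n)\<^sup>2 * (1 - x) = (real n)\<^sup>2 - (real n - 2 * real b)\<^sup>2"
          using n0 by (simp add: x_def power_divide right_diff_distrib)
        also have "\<dots> = 4 * Q" by (simp add: Q_def nb power2_eq_square algebra_simps)
        finally show ?thesis by simp
      qed
      have "(real n)\<^sup>2 / (4 * Q) = 1 / (1 - x)" unfolding Qx using n0 by simp
      also have "\<dots> \<le> 1 + 2 * x"
      proof -
        have "0 \<le> x * (1 - 2 * x)" using x x0 by simp
        then have "1 \<le> (1 + 2 * x) * (1 - x)" by (simp add: algebra_simps)
        then show ?thesis using x by (simp add: pos_divide_le_eq)
      qed
      also have "\<dots> \<le> exp (2 * x)" by (rule exp_ge_add_one_self)
      also have "\<dots> = (exp x)\<^sup>2" by (simp add: power2_eq_square flip: exp_add)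
      finally have "real n / (2 * sqrt Q) \<le> exp x" unfolding base by (intro real_le_lsqrt) auto
      then have "(real n / (2 * sqrt Q)) ^ d \<le> exp x ^ d" using Q0 by (intro power_mono) auto
      also have "\<dots> = T3 b"
        using n0 d by (simp add: T3_def x_def power_divide mult.commute flip: exp_of_nat_mult)
      finally show ?thesis using Hb T_nonneg[of b] by linarith
    next
      case False
      have half: "real n / 2 \<le> max (real b) (real (n - b))" unfolding nb by (auto simp: max_def)
      have "\<eta> * real n * (real n / 2) \<le> Q"
      proof (cases "real b \<le> real (n - b)")
        case True
        then have "\<eta> * real n * (real n / 2) \<le> real b * real (n - b)"
          using half big n0 by (intro mult_mono) (auto simp: \<eta>_def)
        then show ?thesis by (simp add: Q_def)
      next
        case False
        then have "\<eta> * real n * (real n / 2) \<le> real (n - b) * real b"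
          using half big n0 by (intro mult_mono) (auto simp: \<eta>_def)
        then show ?thesis by (simp add: Q_def mult.commute)
      qed
      then have "\<eta> * (real n)\<^sup>2 \<le> 4 * Q" using Q0 by (simp add: power2_eq_square)
      then have "(real n)\<^sup>2 \<le> exp l * (4 * Q)"
        using mult_left_mono[of "\<eta> * (real n)\<^sup>2" "4 * Q" "exp l"] by (simp add: \<eta>_def mult.assoc[symmetric] flip: exp_add)
      then have "(real n)\<^sup>2 / (4 * Q) \<le> exp l"
        using Q0 by (simp add: pos_divide_le_eq)
      also have "\<dots> = (exp (l / 2))\<^sup>2" by (simp add: power2_eq_square flip: exp_add)
      finally have "real n / (2 * sqrt Q) \<le> exp (l / 2)" unfolding base by (intro real_le_lsqrt) auto
      then have "(real n / (2 * sqrt Q)) ^ d \<le> exp (l / 2) ^ d" using Q0 by (intro power_mono) auto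
      also have "\<dots> = exp (real n / 32)"
        using d by (simp add: l_def flip: exp_of_nat_mult)
      also have "\<dots> \<le> T2 b"
      proof -
        have "(real n / 2)\<^sup>2 \<le> (real n - 2 * real b)\<^sup>2"
          using False n0 by (intro abs_le_square_iff[THEN iffD1]) auto
        then have "real n / 16 \<le> (real n - 2 * real b)\<^sup>2 / (4 * real n)"
          using n0 by (simp add: field_simps power2_eq_square)
        then show ?thesis by (simp add: T2_def flip: exp_add)
      qed
      finally show ?thesis using Hb T_nonneg[of b] by linarith
    qed
  qed
  have S1: "(\<Sum>b\<le>n. real (n choose b) * T1 b) \<le> 2 * exp (\<eta> * real n * (1 + l)) / p"
  proof -
    have "(\<Sum>b\<le>n. real (n choose b) * T1 b) = ((\<Sum>b\<le>n. real (n choose b) * exp (- (l * real b)))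
        + (\<Sum>b\<le>n. real (n choose b) * exp (- (l * real (n - b))))) * (exp (l * \<eta> * real n) / p)"
      by (simp only: T1_def sum_distrib_right distrib_left distrib_right mult.assoc sum.distrib)
    also have "\<dots> = 2 * (1 + \<eta>) ^ n * exp (l * \<eta> * real n) / p"
      unfolding sum_choose_exp by (simp add: \<eta>_def)
    also have "\<dots> \<le> 2 * exp (\<eta> * real n) * exp (l * \<eta> * real n) / p"
    proof -
      have "(1 + \<eta>) ^ n \<le> exp \<eta> ^ n" by (intro power_mono exp_ge_add_one_self) (simp add: \<eta>_def)
      then have "(1 + \<eta>) ^ n \<le> exp (\<eta> * real n)" by (simp add: mult.commute flip: exp_of_nat_mult)
      then show ?thesis using p by (intro divide_right_mono mult_right_mono mult_left_mono) auto
    qed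
    also have "\<dots> = 2 * exp (\<eta> * real n * (1 + l)) / p"
      by (simp add: algebra_simps flip: exp_add)
    finally show ?thesis .
  qed
  have S2: "(\<Sum>b\<le>n. real (n choose b) * T2 b) \<le> 2 ^ n * exp (1 / 2 - real n / 32)"
  proof -
    have "(\<Sum>b\<le>n. real (n choose b) * T2 b)
      = (\<Sum>b\<le>n. real (n choose b) * exp ((real n - 2 * real b)\<^sup>2 / (4 * real n))) * exp (real n / 32 - real n / 16)"
      by (simp add: T2_def sum_distrib_right mult.assoc)
    also have "\<dots> \<le> (2 ^ n * exp (real n / (4 * real n - 2 * real n))) * exp (real n / 32 - real n / 16)"
      using n0 by (intro mult_right_mono sum_choose_exp_square_le) auto
    also have "real n / (4 * real n - 2 * real n) = 1 / 2" using n0 by simp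
    finally show ?thesis by (simp add: mult.assoc flip: exp_add)
  qed
  have S3: "(\<Sum>b\<le>n. real (n choose b) * T3 b) \<le> 2 ^ n * exp (real d / (real n - 2 * real d))"
  proof -
    \<comment> \<open>The Gaussian sum is applied with A = n^2 / d, and its condition 2 n < A is
      exactly 2 d < n.\<close>
    have less: "2 * real n < (real n)\<^sup>2 / real d"
      using d n n0 by (simp add: pos_less_divide_eq power2_eq_square)
    have "real n / ((real n)\<^sup>2 / real d - 2 * real n) = real d / (real n - 2 * real d)"
      using d n n0 by (simp add: power2_eq_square field_simps)
    with sum_choose_exp_square_le[OF less] show ?thesis by (simp add: T3_def)
  qed
  have "(\<Sum>b\<le>n. real (n choose b) * H b) \<le> (\<Sum>b\<le>n. real (n choose b) * (T1 b + T2 b + T3 b))"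
    by (intro sum_mono mult_left_mono point) auto
  also have "\<dots> = (\<Sum>b\<le>n. real (n choose b) * T1 b) + (\<Sum>b\<le>n. real (n choose b) * T2 b) + (\<Sum>b\<le>n. real (n choose b) * T3 b)"
    by (simp add: distrib_left sum.distrib)
  also have "\<dots> \<le> 2 * exp (\<eta> * real n * (1 + l)) / p + 2 ^ n * exp (1 / 2 - real n / 32) + 2 ^ n * exp (real d / (real n - 2 * real d))"
    by (intro add_mono S1 S2 S3)
  finally have "(\<Sum>b\<le>n. real (n choose b) * H b) / 2 ^ n \<le> (2 * exp (\<eta> * real n * (1 + l)) / p
      + 2 ^ n * exp (1 / 2 - real n / 32) + 2 ^ n * exp (real d / (real n - 2 * real d))) / 2 ^ n"
    by (rule divide_right_mono) simp
  also have "\<dots> = 2 * exp (\<eta> * real n * (1 + l)) / (2 ^ n * p) + exp (1 / 2 - real n / 32) + exp (real d / (real n - 2 * real d))"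
    by (simp add: add_divide_distrib mult.commute)
  finally show ?thesis by (simp add: \<eta>_def)
qed

section \<open>Counting signings by Hamming distance, and the second moment inequality\<close>

lemma sum_Pow_card:
  fixes h :: "nat \<Rightarrow> real"
  assumes "finite A"
  shows "(\<Sum>B\<in>Pow A. h (card B)) = (\<Sum>b\<le>card A. real (card A choose b) * h b)"
proof -
  have "(\<Sum>B\<in>Pow A. h (card B)) = (\<Sum>b\<le>card A. \<Sum>B\<in>{B \<in> Pow A. card B = b}. h (card B))"
    using assms by (intro sum.group[symmetric]) (auto intro: card_mono)
  also have "\<dots> = (\<Sum>b\<le>card A. real (card {B \<in> Pow A. card B = b}) * h b)"
    by (intro sum.cong refl) simp
  also have "\<dots> = (\<Sum>b\<le>card A. real (card A choose b) * h b)"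
    using n_subsets[OF assms] by (simp add: Pow_def)
  finally show ?thesis .
qed

lemma signs_uminus_iff: "e \<in> signs n \<Longrightarrow> f \<in> signs n \<Longrightarrow> k < n \<Longrightarrow> f k \<noteq> e k \<longleftrightarrow> f k = - e k"
  by (fastforce simp: signs_def PiE_def Pi_def)

text \<open>A signing is determined by the set of positions where it differs from \<open>e\<close>,
  and flipping \<open>e\<close> on any set realises that set.\<close>

lemma sum_signs_hamming:
  fixes h :: "nat \<Rightarrow> real"
  assumes e: "e \<in> signs n"
  shows "(\<Sum>f\<in>signs n. h (card {k. k < n \<and> f k \<noteq> e k})) = (\<Sum>b\<le>n. real (n choose b) * h b)"
proof -
  have "(\<Sum>f\<in>signs n. h (card {k. k < n \<and> f k \<noteq> e k})) = (\<Sum>B\<in>Pow {..<n}. h (card B))"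
  proof (rule sum.reindex_bij_witness[where j="\<lambda>f. {k. k < n \<and> f k \<noteq> e k}"
        and i="\<lambda>B. restrict (\<lambda>k. if k \<in> B then - e k else e k) {..<n}"])
    fix f assume f: "f \<in> signs n"
    show "restrict (\<lambda>k. if k \<in> {k. k < n \<and> f k \<noteq> e k} then - e k else e k) {..<n} = f"
    proof
      fix k
      show "restrict (\<lambda>k. if k \<in> {k. k < n \<and> f k \<noteq> e k} then - e k else e k) {..<n} k = f k"
        using signs_uminus_iff[OF e f, of k] f by (auto simp: signs_def PiE_def extensional_def)
    qed
  next
    fix B assume B: "B \<in> Pow {..<n}"
    have e0: "e k \<noteq> 0" if "k < n" for k using signs_abs[OF e that] by auto
    show "{k. k < n \<and> restrict (\<lambda>k. if k \<in> B then - e k else e k) {..<n} k \<noteq> e k} = B"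
      using B e0 by auto
    show "restrict (\<lambda>k. if k \<in> B then - e k else e k) {..<n} \<in> signs n"
      using e by (auto simp: signs_def PiE_def Pi_def)
  qed auto
  then show ?thesis using sum_Pow_card[of "{..<n}" h] by simp
qed

text \<open>Chebyshev's inequality for the number of events that occur: where none occurs, the
  squared deviation from the mean \<mu> equals \<mu>^2.\<close>

lemma (in prob_space) prob_none_le_second_moment:
  assumes fin: "finite X" and E: "\<And>x. x \<in> X \<Longrightarrow> E x \<in> events"
    and p: "\<And>x. x \<in> X \<Longrightarrow> prob (E x) = p" and pos: "0 < real (card X) * p"
  shows "prob {\<omega> \<in> space M. \<forall>x\<in>X. \<omega> \<notin> E x}
    \<le> (\<Sum>x\<in>X. \<Sum>y\<in>X. prob (E x \<inter> E y)) / (real (card X) * p)\<^sup>2 - 1"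
proof -
  define \<mu> where "\<mu> = real (card X) * p"
  define f where "f \<omega> = (\<Sum>x\<in>X. indicator (E x) \<omega> :: real)" for \<omega>
  let ?A = "{\<omega> \<in> space M. \<forall>x\<in>X. \<omega> \<notin> E x}"
  have int: "integrable M (\<lambda>\<omega>. indicator (E x \<inter> E y) \<omega> :: real)" "integrable M (\<lambda>\<omega>. indicator (E x) \<omega> :: real)"
    if "x \<in> X" "y \<in> X" for x y
    using E that by (auto intro!: integrable_real_indicator simp: emeasure_eq_measure)
  have A: "?A \<in> events" using E fin by measurable
  have sq: "(f \<omega> - \<mu>)\<^sup>2 = (\<Sum>x\<in>X. \<Sum>y\<in>X. indicator (E x \<inter> E y) \<omega>) - 2 * \<mu> * (\<Sum>x\<in>X. indicator (E x) \<omega>) + \<mu>\<^sup>2" for \<omega>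
    by (simp add: f_def power2_diff power2_eq_square[of "sum _ _"] sum_product indicator_inter_arith mult_ac)
  have "\<mu>\<^sup>2 * prob ?A = (\<integral>\<omega>. \<mu>\<^sup>2 * indicator ?A \<omega> \<partial>M)" using A by simp
  also have "\<dots> \<le> (\<integral>\<omega>. (f \<omega> - \<mu>)\<^sup>2 \<partial>M)"
  proof (rule integral_mono)
    show "integrable M (\<lambda>\<omega>. \<mu>\<^sup>2 * indicator ?A \<omega>)"
      using A by (intro integrable_mult_right integrable_real_indicator) (auto simp: emeasure_eq_measure)
    show "integrable M (\<lambda>\<omega>. (f \<omega> - \<mu>)\<^sup>2)" unfolding sq
      by (intro Bochner_Integration.integrable_add Bochner_Integration.integrable_diff
          Bochner_Integration.integrable_sum integrable_mult_right int) auto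
    show "\<mu>\<^sup>2 * indicator ?A \<omega> \<le> (f \<omega> - \<mu>)\<^sup>2" for \<omega>
      by (auto simp: f_def indicator_def)
  qed
  also have "\<dots> = (\<Sum>x\<in>X. \<Sum>y\<in>X. prob (E x \<inter> E y)) - 2 * \<mu> * (\<Sum>x\<in>X. prob (E x)) + \<mu>\<^sup>2"
  proof -
    have "(\<integral>\<omega>. (f \<omega> - \<mu>)\<^sup>2 \<partial>M) = (\<Sum>x\<in>X. \<Sum>y\<in>X. \<integral>\<omega>. indicator (E x \<inter> E y) \<omega> \<partial>M)
        - 2 * \<mu> * (\<Sum>x\<in>X. \<integral>\<omega>. indicator (E x) \<omega> \<partial>M) + \<mu>\<^sup>2"
      unfolding sq using int prob_space
      by (simp add: Bochner_Integration.integral_sum Bochner_Integration.integrable_sum)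
    then show ?thesis using E by (simp add: sets.Int)
  qed
  also have "(\<Sum>x\<in>X. prob (E x)) = \<mu>" by (simp add: p \<mu>_def)
  finally have "\<mu>\<^sup>2 * prob ?A \<le> (\<Sum>x\<in>X. \<Sum>y\<in>X. prob (E x \<inter> E y)) - \<mu>\<^sup>2"
    by (simp add: power2_eq_square)
  then have "prob ?A \<le> ((\<Sum>x\<in>X. \<Sum>y\<in>X. prob (E x \<inter> E y)) - \<mu>\<^sup>2) / \<mu>\<^sup>2"
    using pos unfolding \<mu>_def[symmetric] by (subst pos_le_divide_eq) (simp_all add: mult.commute)
  moreover have "\<mu> \<noteq> 0" using pos unfolding \<mu>_def[symmetric] by simp
  ultimately show ?thesis unfolding \<mu>_def[symmetric] by (simp add: diff_divide_distrib)
qed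

section \<open>Discrepancy of GOE matrices\<close>

definition small_ball :: "nat \<Rightarrow> real \<Rightarrow> real" where
  "small_ball m s = measure (GW.G m) (op_ball m s \<inter> space (GW.L m))"

lemma emeasure_op_ball: "emeasure (GW.G m) (op_ball m s \<inter> space (GW.L m)) = ennreal (small_ball m s)"
  unfolding small_ball_def
  by (rule finite_measure.emeasure_eq_measure[OF prob_space.finite_measure[OF GW.prob_space_G]])

lemma small_ball_nonneg: "0 \<le> small_ball m s"
  by (simp add: small_ball_def)

lemma measure_signed_sum:
  assumes "0 < m" "0 < n" "e \<in> signs n"
  shows "measure (goe_space n m) {\<omega> \<in> space (goe_space n m). GW.psum e {..<n} \<omega> \<in> op_ball m s} = small_ball m s"
proof -
  have "emeasure (GW.P m n) {\<omega> \<in> space (GW.P m n). GW.psum e {..<n} \<omega> \<in> op_ball m s} = ennreal (small_ball m s)"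
    unfolding emeasure_op_ball[symmetric]
    by (rule GW.emeasure_psum_body[OF body_op_ball]) (use assms signs_abs upper_nonempty in auto)
  then show ?thesis
    unfolding goe_space_eq by (simp add: measure_def small_ball_nonneg)
qed

text \<open>The bridge from the hypothesis on \<xi>: one matrix is the signed sum with a single
  summand and sign 1, and every normalised signed sum has the same small-ball probability.\<close>

lemma small_ball_spec_norm:
  assumes "0 < m"
  shows "measure (goe_space 1 m) {\<omega> \<in> space (goe_space 1 m). spec_norm m (goe_mat \<omega> 0) \<le> s} = small_ball m s"
proof -
  define e :: "nat \<Rightarrow> real" where "e = restrict (\<lambda>_. 1) {..<1}"
  have e: "e \<in> signs 1" by (auto simp: e_def signs_def)
  have "spec_norm m (goe_mat \<omega> 0) \<le> s \<longleftrightarrow> GW.psum e {..<1} \<omega> \<in> op_ball m s" for \<omega>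
    using spec_norm_signed_sum_le_iff[OF assms zero_less_one, of e \<omega> s] by (simp add: e_def)
  then show ?thesis using measure_signed_sum[OF assms zero_less_one e] by simp
qed

text \<open>Used twice: from the critical radius \<delta> up to \<gamma> \<delta>, bounding the
  larger ball from below, and from \<beta> \<delta> up to \<delta>, bounding the smaller ball from
  above.\<close>

lemma small_ball_dilate:
  assumes g: "1 \<le> g" and s: "0 \<le> s"
  shows "g ^ card (upper m) * exp (- ((g\<^sup>2 - 1) * (real m * s\<^sup>2 / 2))) * small_ball m s \<le> small_ball m (g * s)"
proof -
  have "{x. (\<lambda>p. 1 / g * x p) \<in> op_ball m s} = op_ball m (g * s)"
    using op_ball_scale[of "1 / g" _ m s] g by (auto simp: mult.commute)
  with GW.emeasure_G_dilate[OF body_op_ball[of m s] g q_op_ball[OF _ s]]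
  have "ennreal (g ^ card (upper m) * exp (- ((g\<^sup>2 - 1) * (real m * s\<^sup>2 / 2)))) * ennreal (small_ball m s) \<le> ennreal (small_ball m (g * s))"
    by (simp only: emeasure_op_ball)
  then show ?thesis
    using g small_ball_nonneg by (simp add: ennreal_mult[symmetric])
qed

lemma prob_space_goe: "prob_space (goe_space n m)"
  unfolding goe_space_eq by (rule GW.prob_space_P)

lemma signed_sum_sets:
  "{\<omega> \<in> space (goe_space n m). GW.psum e {..<n} \<omega> \<in> op_ball m s} \<in> sets (goe_space n m)"
  unfolding goe_space_eq by (rule GW.psum_body_sets[OF body_op_ball order_refl])

lemma disc_event_eq:
  assumes "0 < m" "0 < n"
  shows "{\<omega> \<in> space (goe_space n m). disc n m (goe_mat \<omega>) \<le> sqrt n * s}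
    = (\<Union>e\<in>signs n. {\<omega> \<in> space (goe_space n m). GW.psum e {..<n} \<omega> \<in> op_ball m s})"
  by (auto simp: disc_le_iff[OF assms])

lemma disc_measurable:
  assumes "0 < m" "0 < n"
  shows "(\<lambda>\<omega>. disc n m (goe_mat \<omega>)) \<in> borel_measurable (goe_space n m)"
proof (rule borel_measurable_iff_le[THEN iffD2], rule allI)
  fix a :: real
  have "sqrt n * (a / sqrt n) = a" using assms by simp
  moreover have "{\<omega> \<in> space (goe_space n m). disc n m (goe_mat \<omega>) \<le> sqrt n * (a / sqrt n)} \<in> sets (goe_space n m)"
    unfolding disc_event_eq[OF assms] by (intro sets.finite_UN finite_signs signed_sum_sets)
  ultimately show "{\<omega> \<in> space (goe_space n m). disc n m (goe_mat \<omega>) \<le> a} \<in> sets (goe_space n m)"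
    by simp
qed

section \<open>First and second moment bounds for the discrepancy\<close>

lemma prob_disc_le:
  assumes "0 < m" "0 < n"
  shows "measure (goe_space n m) {\<omega> \<in> space (goe_space n m). disc n m (goe_mat \<omega>) \<le> sqrt n * s} \<le> 2 ^ n * small_ball m s"
proof -
  interpret prob_space "goe_space n m" by (rule prob_space_goe)
  have "prob {\<omega> \<in> space (goe_space n m). disc n m (goe_mat \<omega>) \<le> sqrt n * s}
    \<le> (\<Sum>e\<in>signs n. prob {\<omega> \<in> space (goe_space n m). GW.psum e {..<n} \<omega> \<in> op_ball m s})"
    unfolding disc_event_eq[OF assms]
    by (rule finite_measure_subadditive_finite) (auto intro: signed_sum_sets)
  also have "\<dots> = 2 ^ n * small_ball m s"
    using measure_signed_sum[OF assms] by (simp add: card_signs)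
  finally show ?thesis .
qed

text \<open>The second moment inequality for the number of signings below the threshold. The sum
  over partners of a signing is bounded by the same binomial sum for each signing. In the limit the
  third term tends to 1 and is cancelled by the subtracted 1.\<close>

lemma prob_disc_gt:
  assumes m: "0 < m" and n: "2 * card (upper m) < n" and p: "0 < small_ball m s"
  defines "d \<equiv> card (upper m)"
  defines "l \<equiv> real n / (16 * real d)"
  shows "measure (goe_space n m) {\<omega> \<in> space (goe_space n m). \<not> disc n m (goe_mat \<omega>) \<le> sqrt n * s}
    \<le> 2 * exp (exp (- l) * real n * (1 + l)) / (2 ^ n * small_ball m s) + exp (1 / 2 - real n / 32)
      + exp (real d / (real n - 2 * real d)) - 1"
proof -
  interpret prob_space "goe_space n m" by (rule prob_space_goe)
  define p where "p = small_ball m s"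
  have p0: "0 < p" using \<open>0 < small_ball m s\<close> by (simp add: p_def)
  have n0: "0 < n" using n by simp
  have ne: "upper m \<noteq> {}" using m by (rule upper_nonempty)
  have d0: "0 < d" unfolding d_def using ne by (simp add: card_gt_0_iff)
  define E where "E e = {\<omega> \<in> space (goe_space n m). GW.psum e {..<n} \<omega> \<in> op_ball m s}" for e
  have E: "E e \<in> events" for e unfolding E_def by (rule signed_sum_sets)
  have PE: "prob (E e) = p" if "e \<in> signs n" for e
    unfolding E_def p_def by (rule measure_signed_sum[OF m n0 that])
  \<comment> \<open>A bound for the pair probability divided by p^2, as a function of the Hamming
    distance. At 0 and n one of the agreement classes is empty and the overlap bound does not apply;
    there, and wherever it is better, the probability p of one event alone gives 1 / p.\<close>
  define H where "H b = (if b = 0 \<or> b = n then 1 / p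
    else min (1 / p) ((real n / (2 * sqrt (real b * real (n - b)))) ^ d))" for b
  have pair: "prob (E e \<inter> E f) \<le> p\<^sup>2 * H (card {k. k < n \<and> f k \<noteq> e k})" if e: "e \<in> signs n" and f: "f \<in> signs n" for e f
  proof -
    define b where "b = card {k. k < n \<and> f k \<noteq> e k}"
    have "prob (E e \<inter> E f) \<le> prob (E e)" using E by (intro finite_measure_mono) auto
    also have "\<dots> = p\<^sup>2 * (1 / p)" using PE[OF e] p0 by (simp add: power2_eq_square)
    finally have le1: "prob (E e \<inter> E f) \<le> p\<^sup>2 * (1 / p)" .
    have le2: "prob (E e \<inter> E f) \<le> p\<^sup>2 * (real n / (2 * sqrt (real b * real (n - b)))) ^ d" if b: "b \<noteq> 0" "b \<noteq> n"
    proof -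
      let ?S = "{k. k < n \<and> f k = e k}" and ?T = "{k. k < n \<and> f k \<noteq> e k}"
      have "card ?S + card ?T = card (?S \<union> ?T)" by (rule card_Un_disjoint[symmetric]) auto
      also have "?S \<union> ?T = {..<n}" by auto
      finally have ST: "card ?S + b = n" by (simp add: b_def)
      then have S: "card ?S = n - b" by simp
      have "?S \<noteq> {}" using S ST b by (metis add_0 card.empty)
      moreover have "?T \<noteq> {}" using b unfolding b_def by (metis card.empty)
      ultimately have "emeasure (GW.P m n) {\<omega> \<in> space (GW.P m n). GW.psum e {..<n} \<omega> \<in> op_ball m s \<and> GW.psum f {..<n} \<omega> \<in> op_ball m s}
        \<le> ennreal ((real n / (2 * sqrt (real (card ?S) * real (card ?T)))) ^ card (upper m)) * (ennreal p * ennreal p)"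
        unfolding p_def emeasure_op_ball[symmetric]
        using e f signs_abs signs_uminus_iff[OF e f] ne
        by (intro GW.emeasure_psum_pair[OF body_op_ball]) auto
      also have "{\<omega> \<in> space (GW.P m n). GW.psum e {..<n} \<omega> \<in> op_ball m s \<and> GW.psum f {..<n} \<omega> \<in> op_ball m s} = E e \<inter> E f"
        unfolding E_def goe_space_eq by auto
      finally have "ennreal (prob (E e \<inter> E f)) \<le> ennreal ((real n / (2 * sqrt (real b * real (n - b)))) ^ d * (p * p))"
        unfolding goe_space_eq[symmetric] emeasure_eq_measure S b_def[symmetric] d_def[symmetric]
        using p0 by (simp add: ennreal_mult mult.commute)
      then show ?thesis using p0 by (simp add: power2_eq_square mult_ac)
    qed
    show ?thesis
    proof (cases "b = 0 \<or> b = n")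
      case True
      then show ?thesis using le1 by (simp add: H_def b_def[symmetric])
    next
      case False
      then have "H b = min (1 / p) ((real n / (2 * sqrt (real b * real (n - b)))) ^ d)" by (simp add: H_def)
      then show ?thesis using le1 le2 False by (auto simp: b_def[symmetric] min_def)
    qed
  qed
  have "{\<omega> \<in> space (goe_space n m). \<not> disc n m (goe_mat \<omega>) \<le> sqrt n * s} = {\<omega> \<in> space (goe_space n m). \<forall>e\<in>signs n. \<omega> \<notin> E e}"
    by (auto simp: disc_le_iff[OF m n0] E_def)
  also have "prob \<dots> \<le> (\<Sum>e\<in>signs n. \<Sum>f\<in>signs n. prob (E e \<inter> E f)) / (real (card (signs n)) * p)\<^sup>2 - 1"
    by (rule prob_none_le_second_moment[OF finite_signs E PE]) (use p0 card_signs in auto)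
  also have "(\<Sum>e\<in>signs n. \<Sum>f\<in>signs n. prob (E e \<inter> E f)) \<le> (\<Sum>e\<in>signs n. p\<^sup>2 * (\<Sum>b\<le>n. real (n choose b) * H b))"
  proof (rule sum_mono)
    fix e assume e: "e \<in> signs n"
    have "(\<Sum>f\<in>signs n. prob (E e \<inter> E f)) \<le> (\<Sum>f\<in>signs n. p\<^sup>2 * H (card {k. k < n \<and> f k \<noteq> e k}))"
      by (intro sum_mono pair e)
    also have "\<dots> = p\<^sup>2 * (\<Sum>b\<le>n. real (n choose b) * H b)"
      by (simp add: sum_distrib_left[symmetric] sum_signs_hamming[OF e])
    finally show "(\<Sum>f\<in>signs n. prob (E e \<inter> E f)) \<le> p\<^sup>2 * (\<Sum>b\<le>n. real (n choose b) * H b)" .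
  qed
  also have "(\<Sum>e\<in>signs n. p\<^sup>2 * (\<Sum>b\<le>n. real (n choose b) * H b)) / (real (card (signs n)) * p)\<^sup>2
      = (\<Sum>b\<le>n. real (n choose b) * H b) / 2 ^ n"
    using p0 by (simp add: card_signs power2_eq_square)
  also have "\<dots> \<le> 2 * exp (exp (- l) * real n * (1 + l)) / (2 ^ n * p) + exp (1 / 2 - real n / 32) + exp (real d / (real n - 2 * real d))"
    unfolding l_def
    by (rule sum_choose_overlap_le[OF d0 n[folded d_def] p0]) (use p0 in \<open>auto simp: H_def\<close>)
  finally show ?thesis by (simp add: p_def divide_right_mono diff_right_mono)
qed

text \<open>Both tails lead to exp (d r), where r is an exponent per dimension: - ln \<gamma> or ln
  \<beta> plus vanishing corrections. Its limit is strictly negative because \<beta> < 1 <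
  \<gamma>.\<close>

lemma tendsto_exp_linear_decay:
  fixes d :: "nat \<Rightarrow> nat"
  assumes "filterlim (\<lambda>n. real (d n)) at_top sequentially" "r \<longlonglongrightarrow> c" "c < 0"
  shows "(\<lambda>n. exp (real (d n) * r n)) \<longlonglongrightarrow> 0"
proof -
  have "filterlim (\<lambda>n. r n * real (d n)) at_bot sequentially"
    by (rule filterlim_tendsto_neg_mult_at_bot[OF assms(2,3,1)])
  then show ?thesis
    using filterlim_compose[OF exp_at_bot] by (simp add: mult.commute)
qed

theorem theorem1p1:
  fixes m :: "nat \<Rightarrow> nat" and \<xi> :: "nat \<Rightarrow> real" and \<beta> \<gamma> :: real
  assumes mpos: "\<And>n. m n > 0"
    and m_inf: "filterlim (\<lambda>n. real (m n) ^ 2) at_top sequentially"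
    and m_small: "(\<lambda>n. real (m n) ^ 2 / real n) \<longlonglongrightarrow> 0"
    and xi_lim: "\<xi> \<longlonglongrightarrow> 1"
    and xi_def: "\<forall>\<^sub>F n in sequentially.
       (let \<delta> = 2 / exp (3/4) * sqrt (real (m n)) * 4 powr (- \<xi> n * real n / real (m n) ^ 2)
        in measure (goe_space 1 (m n))
             {\<omega> \<in> space (goe_space 1 (m n)). spec_norm (m n) (goe_mat \<omega> 0) \<le> \<delta>}
           = (exp (3/4) / (2 * sqrt (real (m n))) * \<delta>) powr (real (m n) ^ 2 / (2 * \<xi> n)))"
    and "\<beta> < 1" and "1 < \<gamma>"
  shows "(\<lambda>n. measure (goe_space n (m n))
            {\<omega> \<in> space (goe_space n (m n)).
               \<beta> * (2 / exp (3/4)) * sqrt (real n * real (m n)) * 4 powr (- \<xi> n * real n / real (m n) ^ 2)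
                 \<le> disc n (m n) (goe_mat \<omega>)
             \<and> disc n (m n) (goe_mat \<omega>)
                 \<le> \<gamma> * (2 / exp (3/4)) * sqrt (real n * real (m n)) * 4 powr (- \<xi> n * real n / real (m n) ^ 2)})
         \<longlonglongrightarrow> 1"
proof -
  define c0 :: real where "c0 = 2 / exp (3/4)"
  define d where "d n = card (upper (m n))" for n
  define l where "l n = real n / (16 * real (d n))" for n
  define \<delta> where "\<delta> n = c0 * sqrt (real (m n)) * 4 powr (- \<xi> n * real n / real (m n) ^ 2)" for n
  \<comment> \<open>This is \<delta>^2 / m, which bounds the energy of the critical ball per
    dimension. That it tends to 0 says that \<delta> is o(sqrt m).\<close>
  define \<kappa> where "\<kappa> n = c0\<^sup>2 * (4 powr (- \<xi> n * real n / real (m n) ^ 2))\<^sup>2" for n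
  have c0: "0 < c0" by (simp add: c0_def)
  have d_le: "real (d n) \<le> real (m n) ^ 2" for n
    using card_upper_le[of "m n"] unfolding d_def by (simp flip: of_nat_power)
  have d_ge: "real (m n) ^ 2 \<le> 2 * real (d n)" for n
    using card_upper_ge[of "m n"] unfolding d_def by (metis of_nat_le_iff of_nat_mult of_nat_numeral of_nat_power)
  have d0: "0 < d n" for n
    unfolding d_def using upper_nonempty[OF mpos[of n]] by (simp add: card_gt_0_iff)
  have \<delta>0: "0 < \<delta> n" for n using c0 mpos[of n] by (simp add: \<delta>_def)

  have d_top: "filterlim (\<lambda>n. real (d n)) at_top sequentially"
  proof (rule filterlim_at_top_mono)
    show "filterlim (\<lambda>n. 1 / 2 * real (m n) ^ 2) at_top sequentially"
      by (rule filterlim_tendsto_pos_mult_at_top[OF tendsto_const _ m_inf]) simp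
    show "\<forall>\<^sub>F n in sequentially. 1 / 2 * real (m n) ^ 2 \<le> real (d n)"
      using d_ge by (simp add: field_simps)
  qed
  have ratio_top: "filterlim (\<lambda>n. real n / real (m n) ^ 2) at_top sequentially"
  proof -
    have "\<forall>\<^sub>F n in sequentially. 0 < real (m n) ^ 2 / real n"
      using eventually_gt_at_top[of 0] by eventually_elim (use mpos in simp)
    from filterlim_inverse_at_top[OF m_small this] show ?thesis by simp
  qed
  have l_top: "filterlim l at_top sequentially"
  proof (rule filterlim_at_top_mono)
    show "filterlim (\<lambda>n. 1 / 16 * (real n / real (m n) ^ 2)) at_top sequentially"
      by (rule filterlim_tendsto_pos_mult_at_top[OF tendsto_const _ ratio_top]) simp
    show "\<forall>\<^sub>F n in sequentially. 1 / 16 * (real n / real (m n) ^ 2) \<le> l n"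
    proof (rule always_eventually, rule allI)
      fix n
      have "real n / real (m n) ^ 2 \<le> real n / real (d n)"
        using d_le[of n] d0[of n] mpos[of n] by (intro divide_left_mono mult_pos_pos) auto
      then show "1 / 16 * (real n / real (m n) ^ 2) \<le> l n" by (simp add: l_def)
    qed
  qed
  have \<kappa>_lim: "\<kappa> \<longlonglongrightarrow> 0"
  proof -
    have "filterlim (\<lambda>n. - \<xi> n * (real n / real (m n) ^ 2)) at_bot sequentially"
      by (rule filterlim_tendsto_neg_mult_at_bot[OF tendsto_minus[OF xi_lim] _ ratio_top]) simp
    then have "filterlim (\<lambda>n. ln 4 * (- \<xi> n * (real n / real (m n) ^ 2))) at_bot sequentially"
      by (rule filterlim_tendsto_pos_mult_at_bot[OF tendsto_const, rotated]) simp
    from filterlim_compose[OF exp_at_bot this]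
    have "(\<lambda>n. 4 powr (- \<xi> n * real n / real (m n) ^ 2)) \<longlonglongrightarrow> 0"
      by (simp add: powr_def mult.commute)
    then have "(\<lambda>n. c0\<^sup>2 * (4 powr (- \<xi> n * real n / real (m n) ^ 2))\<^sup>2) \<longlonglongrightarrow> c0\<^sup>2 * 0\<^sup>2"
      by (intro tendsto_intros)
    then show ?thesis by (simp add: \<kappa>_def[abs_def])
  qed
  have energy: "real (m n) * (\<delta> n)\<^sup>2 / 2 \<le> real (d n) * \<kappa> n" for n
  proof -
    have "real (m n) * (\<delta> n)\<^sup>2 = real (m n) ^ 2 * \<kappa> n"
      by (simp add: \<delta>_def \<kappa>_def power_mult_distrib power2_eq_square)
    also have "\<dots> \<le> 2 * real (d n) * \<kappa> n"
      by (intro mult_right_mono d_ge) (simp add: \<kappa>_def)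
    finally show ?thesis by simp
  qed

  \<comment> \<open>The prefactors cancel, and the exponents - \<xi> n / m^2 and m^2 / (2 \<xi>)
    multiply to - n / 2. So \<delta> is the radius at which the expected number of good signings is
    exactly 1.\<close>
  have base: "\<forall>\<^sub>F n in sequentially. 2 ^ n * small_ball (m n) (\<delta> n) = 1"
  proof -
    have xi_pos: "\<forall>\<^sub>F n in sequentially. 0 < \<xi> n"
      using order_tendstoD(1)[OF xi_lim, of 0] by simp
    from xi_def xi_pos show ?thesis
    proof eventually_elim
      case (elim n)
      have mn: "0 < real (m n)" using mpos[of n] by simp
      have "exp (3/4) / (2 * sqrt (real (m n))) * \<delta> n = 4 powr (- \<xi> n * real n / real (m n) ^ 2)"
        using mn by (simp add: \<delta>_def c0_def)
      moreover have "(4 powr (- \<xi> n * real n / real (m n) ^ 2)) powr (real (m n) ^ 2 / (2 * \<xi> n)) = 4 powr (- (real n / 2))"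
        unfolding powr_powr using mn elim(2) by (simp add: field_simps)
      moreover have "4 powr (- (real n / 2)) = 1 / 2 ^ n"
      proof -
        have "(4::real) powr (- (real n / 2)) = ((2::real) powr 2) powr (- (real n / 2))" by simp
        also have "\<dots> = 2 powr (- real n)" unfolding powr_powr by simp
        finally show ?thesis by (simp add: powr_minus powr_realpow inverse_eq_divide)
      qed
      ultimately have "small_ball (m n) (\<delta> n) = 1 / 2 ^ n"
        using elim(1) small_ball_spec_norm[OF mpos[of n], of "\<delta> n"]
        unfolding Let_def c0_def[symmetric] \<delta>_def[symmetric] by simp
      then show ?case by simp
    qed
  qed

  define U where "U n = measure (goe_space n (m n)) {\<omega> \<in> space (goe_space n (m n)). \<not> disc n (m n) (goe_mat \<omega>) \<le> sqrt n * (\<gamma> * \<delta> n)}" for n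
  have U: "U \<longlonglongrightarrow> 0"
  proof -
    \<comment> \<open>With n = 16 l d, the exponent exp (- l) n (1 + l) that bounds the number of
      close pairs is d times a quantity vanishing as l grows. ln \<gamma> is the volume gain of the
      dilation and the last term its Gaussian loss.\<close>
    define r where "r n = exp (- l n) * (16 * l n) * (1 + l n) - ln \<gamma> + (\<gamma>\<^sup>2 - 1) * \<kappa> n" for n
    have r: "r \<longlonglongrightarrow> 0 - ln \<gamma> + (\<gamma>\<^sup>2 - 1) * 0"
    proof -
      have "((\<lambda>x::real. exp (- x) * (16 * x) * (1 + x)) \<longlongrightarrow> 0) at_top" by real_asymp
      from filterlim_compose[OF this l_top]
      show ?thesis unfolding r_def[abs_def] by (intro tendsto_intros \<kappa>_lim)
    qed
    \<comment> \<open>The last exponential is the bulk of the second moment: d / (n - 2 d) = 1 / (16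
      l - 2) tends to 0.\<close>
    define B where "B n = 2 * exp (real (d n) * r n) + exp (1 / 2 - real n / 32) + exp (1 / (16 * l n - 2)) - 1" for n
    have "(\<lambda>n. exp (real (d n) * r n)) \<longlonglongrightarrow> 0"
      by (rule tendsto_exp_linear_decay[OF d_top r]) (use \<open>1 < \<gamma>\<close> in simp)
    moreover have "(\<lambda>n. exp (1 / 2 - real n / 32)) \<longlonglongrightarrow> 0" by real_asymp
    moreover have "(\<lambda>n. exp (1 / (16 * l n - 2))) \<longlonglongrightarrow> 1"
    proof -
      have "((\<lambda>x::real. exp (1 / (16 * x - 2))) \<longlongrightarrow> 1) at_top" by real_asymp
      from filterlim_compose[OF this l_top] show ?thesis .
    qed
    ultimately have "B \<longlonglongrightarrow> 2 * 0 + 0 + 1 - 1"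
      unfolding B_def[abs_def] by (intro tendsto_intros)
    then have B: "B \<longlonglongrightarrow> 0" by simp
    have "\<forall>\<^sub>F n in sequentially. 1 < l n" using l_top by (simp add: filterlim_at_top_dense)
    with base have le: "\<forall>\<^sub>F n in sequentially. U n \<le> B n"
    proof eventually_elim
      case (elim n)
      have nl: "real n = 16 * l n * real (d n)" using d0[of n] by (simp add: l_def)
      have "2 * real (d n) < real n" using elim(2) d0[of n] unfolding nl by simp
      then have n: "2 * card (upper (m n)) < n" by (simp add: d_def)
      define p where "p = small_ball (m n) (\<gamma> * \<delta> n)"
      have "\<gamma> ^ d n * exp (- ((\<gamma>\<^sup>2 - 1) * (real (m n) * (\<delta> n)\<^sup>2 / 2))) * small_ball (m n) (\<delta> n) \<le> p"
        unfolding p_def d_def by (rule small_ball_dilate) (use \<open>1 < \<gamma>\<close> \<delta>0[of n] in auto)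
      then have "2 ^ n * (\<gamma> ^ d n * exp (- ((\<gamma>\<^sup>2 - 1) * (real (m n) * (\<delta> n)\<^sup>2 / 2))) * small_ball (m n) (\<delta> n)) \<le> 2 ^ n * p"
        by (rule mult_left_mono) simp
      moreover have "2 ^ n * (\<gamma> ^ d n * exp (- ((\<gamma>\<^sup>2 - 1) * (real (m n) * (\<delta> n)\<^sup>2 / 2))) * small_ball (m n) (\<delta> n))
        = \<gamma> ^ d n * exp (- ((\<gamma>\<^sup>2 - 1) * (real (m n) * (\<delta> n)\<^sup>2 / 2)))"
        using elim(1) by (simp only: mult.left_commute[of "2 ^ n"] mult_1_right)
      ultimately have "\<gamma> ^ d n * exp (- ((\<gamma>\<^sup>2 - 1) * (real (m n) * (\<delta> n)\<^sup>2 / 2))) \<le> 2 ^ n * p"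
        by (simp only:)
      moreover have "\<gamma> ^ d n = exp (real (d n) * ln \<gamma>)"
        using \<open>1 < \<gamma>\<close> by (simp add: exp_of_nat_mult)
      moreover have "exp (- ((\<gamma>\<^sup>2 - 1) * (real (d n) * \<kappa> n))) \<le> exp (- ((\<gamma>\<^sup>2 - 1) * (real (m n) * (\<delta> n)\<^sup>2 / 2)))"
        using mult_left_mono[OF energy[of n], of "\<gamma>\<^sup>2 - 1"] \<open>1 < \<gamma>\<close> by simp
      ultimately have low: "exp (real (d n) * ln \<gamma>) * exp (- ((\<gamma>\<^sup>2 - 1) * (real (d n) * \<kappa> n))) \<le> 2 ^ n * p"
        by (simp only:) (rule order_trans[OF mult_left_mono[OF _ exp_ge_zero]])
      then have pos: "0 < 2 ^ n * p" by (rule less_le_trans[rotated]) simp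
      then have p0: "0 < small_ball (m n) (\<gamma> * \<delta> n)" by (simp add: p_def zero_less_mult_iff)
      have "U n \<le> 2 * exp (exp (- l n) * real n * (1 + l n)) / (2 ^ n * p) + exp (1 / 2 - real n / 32)
          + exp (real (d n) / (real n - 2 * real (d n))) - 1"
        using prob_disc_gt[OF mpos[of n] n p0] by (simp add: U_def p_def l_def d_def)
      moreover have "real (d n) / (real n - 2 * real (d n)) = 1 / (16 * l n - 2)"
      proof -
        have "real n - 2 * real (d n) = real (d n) * (16 * l n - 2)" by (simp add: nl algebra_simps)
        then show ?thesis using d0[of n] by simp
      qed
      moreover have "2 * exp (exp (- l n) * real n * (1 + l n)) / (2 ^ n * p) \<le> 2 * exp (real (d n) * r n)"
      proof -
        have "exp (real (d n) * r n) * (exp (real (d n) * ln \<gamma>) * exp (- ((\<gamma>\<^sup>2 - 1) * (real (d n) * \<kappa> n))))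
            = exp (exp (- l n) * real n * (1 + l n))"
          unfolding nl r_def by (simp add: algebra_simps flip: exp_add)
        then have "exp (exp (- l n) * real n * (1 + l n)) \<le> exp (real (d n) * r n) * (2 ^ n * p)"
          using mult_left_mono[OF low, of "exp (real (d n) * r n)"] by simp
        then show ?thesis using pos by (simp add: pos_divide_le_eq)
      qed
      ultimately have "U n \<le> B n" unfolding B_def by (simp only:)
      then show ?case .
    qed
    show ?thesis
      by (rule tendsto_sandwich[OF _ le tendsto_const B]) (simp add: U_def)
  qed

  define W where "W n = measure (goe_space n (m n)) {\<omega> \<in> space (goe_space n (m n)). \<not> sqrt n * (\<beta> * \<delta> n) \<le> disc n (m n) (goe_mat \<omega>)}" for n
  have W: "W \<longlonglongrightarrow> 0"
  proof (cases "\<beta> \<le> 0")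
    \<comment> \<open>The discrepancy is nonnegative, so the lower bound holds everywhere; the other
      case needs ln \<beta>.\<close>
    case True
    have "W n = 0" for n
    proof -
      have "sqrt n * (\<beta> * \<delta> n) \<le> disc n (m n) (goe_mat \<omega>)" for \<omega>
      proof (rule order_trans[OF _ disc_nonneg[OF mpos[of n]]])
        show "sqrt n * (\<beta> * \<delta> n) \<le> 0"
          using True \<delta>0[of n] by (intro mult_nonneg_nonpos mult_nonpos_nonneg) auto
      qed
      then show ?thesis by (simp add: W_def)
    qed
    then have "W = (\<lambda>_. 0)" by blast
    then show ?thesis by simp
  next
    case False
    then have \<beta>: "0 < \<beta>" "\<beta> < 1" using \<open>\<beta> < 1\<close> by auto
    define r where "r n = ln \<beta> + (1 - \<beta>\<^sup>2) * \<kappa> n" for n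
    have r: "r \<longlonglongrightarrow> ln \<beta> + (1 - \<beta>\<^sup>2) * 0"
      unfolding r_def[abs_def] by (intro tendsto_intros \<kappa>_lim)
    show ?thesis
    proof (rule tendsto_sandwich[where f="\<lambda>_. 0"])
      show "(\<lambda>n. exp (real (d n) * r n)) \<longlonglongrightarrow> 0"
        by (rule tendsto_exp_linear_decay[OF d_top r]) (use \<beta> in simp)
      show "\<forall>\<^sub>F n in sequentially. 0 \<le> W n" by (simp add: W_def)
      from base eventually_gt_at_top[of 0]
      show "\<forall>\<^sub>F n in sequentially. W n \<le> exp (real (d n) * r n)"
      proof eventually_elim
        case (elim n)
        interpret prob_space "goe_space n (m n)" by (rule prob_space_goe)
        note [measurable] = disc_measurable[OF mpos[of n] elim(2)]
        have "W n \<le> prob {\<omega> \<in> space (goe_space n (m n)). disc n (m n) (goe_mat \<omega>) \<le> sqrt n * (\<beta> * \<delta> n)}"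
          unfolding W_def by (intro finite_measure_mono) auto
        also have "\<dots> \<le> 2 ^ n * small_ball (m n) (\<beta> * \<delta> n)"
          by (rule prob_disc_le[OF mpos elim(2)])
        also have "\<dots> \<le> exp (real (d n) * r n)"
        proof -
          define p where "p = small_ball (m n) (\<beta> * \<delta> n)"
          \<comment> \<open>Dilating by 1 / \<beta> leads from radius \<beta> \<delta> back to
            \<delta>, where the probability is known. The energy is taken at the smaller radius, so
            (1 / \<beta>^2 - 1) \<beta>^2 becomes 1 - \<beta>^2.\<close>
          have "(1 / \<beta>) ^ d n * exp (- (((1 / \<beta>)\<^sup>2 - 1) * (real (m n) * (\<beta> * \<delta> n)\<^sup>2 / 2))) * p \<le> small_ball (m n) (\<delta> n)"
            using small_ball_dilate[of "1 / \<beta>" "\<beta> * \<delta> n" "m n"] \<beta> \<delta>0[of n] by (simp add: p_def d_def)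
          moreover have "((1 / \<beta>)\<^sup>2 - 1) * (real (m n) * (\<beta> * \<delta> n)\<^sup>2 / 2) = (1 - \<beta>\<^sup>2) * (real (m n) * (\<delta> n)\<^sup>2 / 2)"
            using \<beta> by (simp add: field_simps power2_eq_square)
          moreover have "(1 / \<beta>) ^ d n = exp (- (real (d n) * ln \<beta>))"
            using \<beta> by (simp add: exp_minus exp_of_nat_mult power_one_over inverse_eq_divide)
          ultimately have "exp (- (real (d n) * ln \<beta>)) * exp (- ((1 - \<beta>\<^sup>2) * (real (m n) * (\<delta> n)\<^sup>2 / 2))) * p \<le> small_ball (m n) (\<delta> n)"
            by (simp only:)
          moreover have "exp (- ((1 - \<beta>\<^sup>2) * (real (d n) * \<kappa> n))) \<le> exp (- ((1 - \<beta>\<^sup>2) * (real (m n) * (\<delta> n)\<^sup>2 / 2)))"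
            using mult_left_mono[OF energy[of n], of "1 - \<beta>\<^sup>2"] \<beta> by (simp add: power_le_one)
          moreover have "0 \<le> p" by (simp add: p_def small_ball_nonneg)
          ultimately have "exp (- (real (d n) * ln \<beta>)) * exp (- ((1 - \<beta>\<^sup>2) * (real (d n) * \<kappa> n))) * p \<le> small_ball (m n) (\<delta> n)"
            by - (rule order_trans[OF mult_right_mono[OF mult_left_mono[OF _ exp_ge_zero]]])
          also have "exp (- (real (d n) * ln \<beta>)) * exp (- ((1 - \<beta>\<^sup>2) * (real (d n) * \<kappa> n))) = exp (- (real (d n) * r n))"
            by (simp add: r_def algebra_simps flip: exp_add)
          finally have "2 ^ n * (exp (- (real (d n) * r n)) * p) \<le> 2 ^ n * small_ball (m n) (\<delta> n)"
            by (rule mult_left_mono) simp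
          then have "exp (- (real (d n) * r n)) * (2 ^ n * p) \<le> 1"
            unfolding elim(1) by (simp only: mult_ac)
          then have "exp (real (d n) * r n) * (exp (- (real (d n) * r n)) * (2 ^ n * p)) \<le> exp (real (d n) * r n) * 1"
            by (rule mult_left_mono) simp
          then show ?thesis by (simp add: p_def mult.assoc[symmetric] flip: exp_add)
        qed
        finally show ?case .
      qed
    qed simp
  qed

  show ?thesis
  proof (rule tendsto_sandwich)
    have "(\<lambda>n. 1 - W n - U n) \<longlonglongrightarrow> 1 - 0 - 0" by (intro tendsto_intros U W)
    then show "(\<lambda>n. 1 - W n - U n) \<longlonglongrightarrow> 1" by simp
    let ?E = "\<lambda>n. {\<omega> \<in> space (goe_space n (m n)).
               \<beta> * (2 / exp (3/4)) * sqrt (real n * real (m n)) * 4 powr (- \<xi> n * real n / real (m n) ^ 2)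
                 \<le> disc n (m n) (goe_mat \<omega>)
             \<and> disc n (m n) (goe_mat \<omega>)
                 \<le> \<gamma> * (2 / exp (3/4)) * sqrt (real n * real (m n)) * 4 powr (- \<xi> n * real n / real (m n) ^ 2)}"
    have E: "?E n = {\<omega> \<in> space (goe_space n (m n)). sqrt n * (\<beta> * \<delta> n) \<le> disc n (m n) (goe_mat \<omega>)
        \<and> disc n (m n) (goe_mat \<omega>) \<le> sqrt n * (\<gamma> * \<delta> n)}" for n
      by (simp only: \<delta>_def c0_def real_sqrt_mult mult_ac)
    show "\<forall>\<^sub>F n in sequentially. 1 - W n - U n \<le> measure (goe_space n (m n)) (?E n)"
      using eventually_gt_at_top[of 0]
    proof eventually_elim
      case (elim n)
      interpret prob_space "goe_space n (m n)" by (rule prob_space_goe)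
      note [measurable] = disc_measurable[OF mpos[of n] elim]
      let ?A = "{\<omega> \<in> space (goe_space n (m n)). \<not> sqrt n * (\<beta> * \<delta> n) \<le> disc n (m n) (goe_mat \<omega>)}"
      let ?B = "{\<omega> \<in> space (goe_space n (m n)). \<not> disc n (m n) (goe_mat \<omega>) \<le> sqrt n * (\<gamma> * \<delta> n)}"
      have ev: "?A \<in> events" "?B \<in> events" "?E n \<in> events" unfolding E by measurable
      have "1 = prob (?E n \<union> (?A \<union> ?B))"
      proof -
        have "?E n \<union> (?A \<union> ?B) = space (goe_space n (m n))" unfolding E by auto
        then show ?thesis using prob_space by metis
      qed
      also have "\<dots> \<le> prob (?E n) + prob (?A \<union> ?B)" using ev by (intro measure_Un_le) auto
      also have "prob (?A \<union> ?B) \<le> W n + U n"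
        unfolding W_def U_def using ev by (intro measure_Un_le) auto
      finally show ?case by simp
    qed
    show "\<forall>\<^sub>F n in sequentially. measure (goe_space n (m n)) (?E n) \<le> 1"
      by (intro always_eventually allI prob_space.prob_le_1 prob_space_goe)
  qed simp
qed

end
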